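(* For all $k \in \mathbb{N}$ we have $\mathrm{minvdeg}(\mathcal{MU}_{\delta=k}) \le \mathrm{N}_1(k)$, where $\mathrm{N}_1 = \mathrm{nM}([2,4,5,6,8,8])$ and $[2,4,5,6,8,8]$ denotes the function $f : \mathbb{N} \to \mathbb{N} \cup \{+\infty\}$ with $(f(1),\dots,f(6)) = (2,4,5,6,8,8)$ and $f(k) = +\infty$ for $k \ge 7$.
   Context: Literals come with a fixed-point-free involution $x \mapsto \overline{x}$; variables are positive literals. A clause is a finite set $C$ of literals with $C \cap \overline{C} = \emptyset$; a clause-set is a finite set of clauses; $\delta(F) = |F| - |\mathrm{var}(F)|$. $\mathcal{MU}_{\delta=k}$ is the class of minimally unsatisfiable clause-sets (unsatisfiable, satisfiable after removing any clause) with $\delta = k$. $\mathrm{vdeg}_F(v)$ is the number of clauses of $F$ containing $v$ or $\overline{v}$; $\mathrm{minvdeg}(F) = \min_{v \in \mathrm{var}(F)} \mathrm{vdeg}_F(v)$; for a class $\mathcal{D}$, $\mathrm{minvdeg}(\mathcal{D})$ is the supremum of $\mathrm{minvdeg}(F)$ over $F \in \mathcal{D}$ with $\mathrm{var}(F) \ne \emptyset$. For $g : \mathbb{N} \to \mathbb{N} \cup \{+\infty\}$ and $k \ge 2$, $m \ge 4$, $\mathrm{pdp}_g(k,m)$ is the set of pairs $(e_0,e_1) \in \mathbb{N}^2$ with (i) $e_0, e_1 \ge 2$; (ii) $e_0,e_1 \le k$; (iii) $e_0+e_1 = m$; (iv) $e_0 \le e_1$; (v) $g(k-e_\varepsilon+1)+e_\varepsilon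 \ge m$ for both $\varepsilon \in \{0,1\}$. For $f$ with $f(1) = 2$, $f' = \mathrm{nM}(f)$ is defined by $f'(1) = 2$ and, for $k > 1$, $f'(k) = \min(m, f(k))$ where $m$ is the largest integer in $\{4,\dots,2k\}$ with $\mathrm{pdp}_{f'}(k,m) \ne \emptyset$ (this uses only $f'(k')$ for $k' < k$). *)

theory Defs
  imports Main "HOL-Library.Extended_Nat"
begin

datatype lit = Pos nat | Neg nat

fun comp :: "lit \<Rightarrow> lit" where
  "comp (Pos v) = Neg v"
| "comp (Neg v) = Pos v"

fun var_of :: "lit \<Rightarrow> nat" where
  "var_of (Pos v) = v"
| "var_of (Neg v) = v"

definition is_clause :: "lit set \<Rightarrow> bool" where
  "is_clause C \<longleftrightarrow> finite C \<and> C \<inter> comp ` C = {}"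

definition is_clause_set :: "lit set set \<Rightarrow> bool" where
  "is_clause_set F \<longleftrightarrow> finite F \<and> (\<forall>C\<in>F. is_clause C)"

definition vars :: "lit set set \<Rightarrow> nat set" where
  "vars F = var_of ` (\<Union>F)"

definition delta :: "lit set set \<Rightarrow> int" where
  "delta F = int (card F) - int (card (vars F))"

fun lit_true :: "(nat \<Rightarrow> bool) \<Rightarrow> lit \<Rightarrow> bool" where
  "lit_true \<phi> (Pos v) = \<phi> v"
| "lit_true \<phi> (Neg v) = (\<not> \<phi> v)"

definition satisfiable :: "lit set set \<Rightarrow> bool" where
  "satisfiable F \<longleftrightarrow> (\<exists>\<phi>. \<forall>C\<in>F. \<exists>x\<in>C. lit_true \<phi> x)"

definition MU :: "lit set set \<Rightarrow> bool" where
  "MU F \<longleftrightarrow> is_clause_set F \<and> \<not> satisfiable F \<and> (\<forall>C\<in>F. satisfiable (F - {C}))"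

definition MU_delta :: "int \<Rightarrow> lit set set set" where
  "MU_delta k = {F. MU F \<and> delta F = k}"

definition vdeg :: "lit set set \<Rightarrow> nat \<Rightarrow> nat" where
  "vdeg F v = card {C\<in>F. Pos v \<in> C \<or> Neg v \<in> C}"

definition minvdeg :: "lit set set \<Rightarrow> nat" where
  "minvdeg F = Min (vdeg F ` vars F)"

text \<open>minvdeg of a class: supremum (in \<open>enat\<close>, so possibly infinite) over the
  members with at least one variable; the supremum of the empty set is 0.\<close>
definition minvdeg_class :: "lit set set set \<Rightarrow> enat" where
  "minvdeg_class D = Sup {enat (minvdeg F) | F. F \<in> D \<and> vars F \<noteq> {}}"

definition pdp :: "(nat \<Rightarrow> enat) \<Rightarrow> nat \<Rightarrow> nat \<Rightarrow> (nat \<times> nat) set" where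
  "pdp g k m = {(e0, e1). 2 \<le> e0 \<and> 2 \<le> e1 \<and> e0 \<le> k \<and> e1 \<le> k \<and> e0 + e1 = m \<and> e0 \<le> e1
      \<and> g (k - e0 + 1) + enat e0 \<ge> enat m \<and> g (k - e1 + 1) + enat e1 \<ge> enat m}"

text \<open>\<open>nM_aux f n\<close> agrees with \<open>nM(f)\<close> on arguments \<open>1..n\<close>; the value at \<open>k\<close>
  only uses values at arguments \<open>< k\<close>.\<close>
fun nM_aux :: "(nat \<Rightarrow> enat) \<Rightarrow> nat \<Rightarrow> (nat \<Rightarrow> enat)" where
  "nM_aux f 0 = (\<lambda>_. 0)"
| "nM_aux f (Suc n) =
     (let g = nM_aux f n in
      g(Suc n := (if Suc n = 1 then 2
                  else min (enat (GREATEST m. m \<in> {4..2 * Suc n} \<and> pdp g (Suc n) m \<noteq> {}))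
                           (f (Suc n)))))"

definition nM :: "(nat \<Rightarrow> enat) \<Rightarrow> nat \<Rightarrow> enat" where
  "nM f k = nM_aux f k k"

text \<open>The function [2,4,5,6,8,8] (value at 0 irrelevant; set to infinity).\<close>
definition f_248 :: "nat \<Rightarrow> enat" where
  "f_248 k = (if k = 1 then 2 else if k = 2 then 4 else if k = 3 then 5 else if k = 4 then 6
              else if k = 5 then 8 else if k = 6 then 8 else \<infinity>)"

definition N1 :: "nat \<Rightarrow> enat" where
  "N1 = nM f_248"

end

theory Submission
  imports Defs
begin

text \<open>
  Setting a literal \<open>x\<close> to true in a saturated minimally unsatisfiable \<open>F\<close> again gives a minimally
  unsatisfiable clause-set, in which the deficiency has dropped by \<open>ldeg F x - 1\<close> and every degree by
  at most \<open>ldeg F x\<close>, provided that no further variable disappears. Applied to both literals of a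
  variable of minimal degree this yields the recursion behind \<open>nM\<close>, and the values of the bound up
  to deficiency 5 follow at once.

  For deficiency 6 the recursion only gives 9. In a saturated counterexample of minimal size every
  variable of degree 9 has a literal \<open>x\<close> of degree 5, and setting \<open>x\<close> to true gives \<open>G\<close> of deficiency 2
  and minimal degree 4. The variables of degree 4 in \<open>G\<close> (at least two of them) must occur in all five
  clauses with \<open>x\<close>. If \<open>G\<close> has no unit clause, the caterpillar shape of the two deficiency-1 splittings
  of \<open>G\<close> provides binary clauses with these variables. Confronting the binary clauses of
  \<open>G\<close> with those obtained from the degree-5 literal of one of its degree-4 variables shows that
  there are exactly two variables of degree 4, occurring in four common clauses with all four sign
  patterns. Contracting these four clauses leaves deficiency 1, where some
  variable has degree at most 2; so no other variable exists, and five distinct clauses over three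
  variables would all have to contain \<open>x\<close> and both other variables.
\<close>

section \<open>Literals, clauses and degrees\<close>

lemma comp_comp [simp]: "comp (comp x) = x"
  by (cases x) auto

lemma comp_neq [simp]: "comp x \<noteq> x" "x \<noteq> comp x"
  by (cases x; simp)+

lemma comp_eq_iff [simp]: "comp x = comp y \<longleftrightarrow> x = y"
  by (cases x; cases y) auto

lemma var_of_comp [simp]: "var_of (comp x) = var_of x"
  by (cases x) auto

lemma var_of_eq_iff: "var_of x = var_of y \<longleftrightarrow> x = y \<or> x = comp y"
  by (cases x; cases y) auto

lemma lit_true_comp [simp]: "lit_true \<phi> (comp x) \<longleftrightarrow> \<not> lit_true \<phi> x"
  by (cases x) auto

lemma var_of_image_iff: "var_of x \<in> var_of ` C \<longleftrightarrow> x \<in> C \<or> comp x \<in> C"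
  by (auto simp: image_iff var_of_eq_iff intro: bexI[of _ "comp x"])

definition set_lit :: "(nat \<Rightarrow> bool) \<Rightarrow> lit \<Rightarrow> nat \<Rightarrow> bool" where
  "set_lit \<phi> x = \<phi>(var_of x := (x = Pos (var_of x)))"

lemma lit_true_set_lit: "lit_true (set_lit \<phi> x) z \<longleftrightarrow> z = x \<or> (lit_true \<phi> z \<and> z \<noteq> comp x)"
  by (cases x; cases z) (auto simp: set_lit_def)

definition sat_by :: "(nat \<Rightarrow> bool) \<Rightarrow> lit set set \<Rightarrow> bool" where
  "sat_by \<phi> F \<longleftrightarrow> (\<forall>C\<in>F. \<exists>x\<in>C. lit_true \<phi> x)"

lemma satisfiable_iff: "satisfiable F \<longleftrightarrow> (\<exists>\<phi>. sat_by \<phi> F)"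
  by (simp add: satisfiable_def sat_by_def)

lemma satisfiable_mono: "satisfiable G" if "satisfiable F" "G \<subseteq> F"
  using that by (auto simp: satisfiable_def)

definition ldeg :: "lit set set \<Rightarrow> lit \<Rightarrow> nat" where
  "ldeg F x = card {C\<in>F. x \<in> C}"

lemma vdeg_alt: "vdeg F v = card {C\<in>F. v \<in> var_of ` C}"
proof -
  have "Pos v \<in> C \<or> Neg v \<in> C \<longleftrightarrow> v \<in> var_of ` C" for C
    using var_of_image_iff[of "Pos v" C] by simp
  then show ?thesis by (simp add: vdeg_def)
qed

lemma is_clause_comp: "is_clause C \<Longrightarrow> x \<in> C \<Longrightarrow> comp x \<notin> C"
  by (auto simp: is_clause_def)

lemma is_clauseI: "finite C \<Longrightarrow> (\<And>x. x \<in> C \<Longrightarrow> comp x \<notin> C) \<Longrightarrow> is_clause C"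
  by (auto simp: is_clause_def)

lemma vdeg_ldeg:
  assumes "is_clause_set F"
  shows "vdeg F (var_of x) = ldeg F x + ldeg F (comp x)"
proof -
  have "{C\<in>F. var_of x \<in> var_of ` C} = {C\<in>F. x \<in> C} \<union> {C\<in>F. comp x \<in> C}"
    by (auto simp: var_of_image_iff)
  moreover have "{C\<in>F. x \<in> C} \<inter> {C\<in>F. comp x \<in> C} = {}"
    using assms is_clause_comp by (auto simp: is_clause_set_def)
  ultimately show ?thesis
    using assms by (simp add: vdeg_alt ldeg_def card_Un_disjoint is_clause_set_def)
qed

lemma in_vars_iff: "v \<in> vars F \<longleftrightarrow> (\<exists>C\<in>F. v \<in> var_of ` C)"
  by (auto simp: vars_def)

lemma finite_vars: "is_clause_set F \<Longrightarrow> finite (vars F)"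
  by (auto simp: vars_def is_clause_set_def is_clause_def)

lemma vdeg_pos_iff: "is_clause_set F \<Longrightarrow> 0 < vdeg F v \<longleftrightarrow> v \<in> vars F"
  by (auto simp: vdeg_alt card_gt_0_iff in_vars_iff is_clause_set_def)

lemma ldeg_pos_iff: "is_clause_set F \<Longrightarrow> 0 < ldeg F x \<longleftrightarrow> (\<exists>C\<in>F. x \<in> C)"
  by (auto simp: ldeg_def card_gt_0_iff is_clause_set_def)

lemma vars_litE:
  assumes "v \<in> vars F"
  obtains x where "var_of x = v"
  using assms by (auto simp: vars_def)

section \<open>First properties of minimally unsatisfiable clause-sets\<close>

lemma MU_clause_set: "MU F \<Longrightarrow> is_clause_set F"
  by (simp add: MU_def)

lemma MU_finite: "MU F \<Longrightarrow> finite F"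
  by (simp add: MU_def is_clause_set_def)

lemma MU_comp: "MU F \<Longrightarrow> C \<in> F \<Longrightarrow> x \<in> C \<Longrightarrow> comp x \<notin> C"
  by (auto simp: MU_def is_clause_set_def is_clause_comp)

lemma MU_unsat: "MU F \<Longrightarrow> \<not> sat_by \<phi> F"
  by (auto simp: MU_def satisfiable_iff)

lemma MU_witness:
  assumes "MU F" "C \<in> F"
  obtains \<phi> where "sat_by \<phi> (F - {C})" "\<And>x. x \<in> C \<Longrightarrow> \<not> lit_true \<phi> x"
proof -
  obtain \<phi> where \<phi>: "sat_by \<phi> (F - {C})"
    using assms by (auto simp: MU_def satisfiable_iff)
  have "\<not> sat_by \<phi> F" using assms MU_unsat by blast
  with \<phi> have "\<not> lit_true \<phi> x" if "x \<in> C" for x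
    using that by (auto simp: sat_by_def)
  with \<phi> that show ?thesis by blast
qed

text \<open>The assignment showing that \<open>D\<close> is needed falsifies \<open>D\<close>, hence
  also its subset \<open>C\<close>, which it would have to satisfy if \<open>C\<close> were a
  different clause.\<close>

lemma MU_subset_eq:
  assumes "MU F" "C \<in> F" "D \<in> F" "C \<subseteq> D"
  shows "C = D"
proof (rule ccontr)
  assume "C \<noteq> D"
  obtain \<phi> where "sat_by \<phi> (F - {D})" "\<And>x. x \<in> D \<Longrightarrow> \<not> lit_true \<phi> x"
    using MU_witness[OF assms(1,3)] by blast
  with assms \<open>C \<noteq> D\<close> show False by (auto simp: sat_by_def)
qed

text \<open>Take an assignment failing only at \<open>C\<close> and make \<open>x\<close> true. Now
  \<open>C\<close> is satisfied, so another clause must have become false, and it can only have lost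
  \<open>comp x\<close>.\<close>

lemma MU_not_pure:
  assumes "MU F" "C \<in> F" "x \<in> C"
  obtains D where "D \<in> F" "comp x \<in> D"
proof -
  obtain \<phi> where \<phi>: "sat_by \<phi> (F - {C})" "\<And>x. x \<in> C \<Longrightarrow> \<not> lit_true \<phi> x"
    using MU_witness[OF assms(1,2)] by blast
  have "\<not> sat_by (set_lit \<phi> x) F" using assms MU_unsat by blast
  then obtain D where D: "D \<in> F" "\<forall>z\<in>D. \<not> lit_true (set_lit \<phi> x) z"
    by (auto simp: sat_by_def)
  then have "D \<noteq> C" using assms by (auto simp: lit_true_set_lit)
  then obtain z where "z \<in> D" "lit_true \<phi> z" using \<phi>(1) D(1) unfolding sat_by_def by blast
  with D have "comp x \<in> D" by (auto simp: lit_true_set_lit)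
  with D that show ?thesis by blast
qed

lemma MU_ldeg_pos:
  assumes "MU F" "var_of x \<in> vars F"
  shows "0 < ldeg F x"
proof -
  obtain C where "C \<in> F" "x \<in> C \<or> comp x \<in> C"
    using assms by (auto simp: in_vars_iff var_of_image_iff)
  then have "\<exists>D\<in>F. x \<in> D" using MU_not_pure[OF assms(1), of C "comp x"] by auto
  then show ?thesis using ldeg_pos_iff MU_clause_set assms by blast
qed

lemma MU_nonempty: "MU F \<Longrightarrow> F \<noteq> {}"
  by (auto simp: MU_def satisfiable_def)

lemma MU_empty_clause: "MU F \<Longrightarrow> {} \<in> F \<Longrightarrow> F = {{}}"
  using MU_subset_eq[of F "{}"] by auto

lemma MU_no_vars:
  assumes "MU F" "vars F = {}"
  shows "F = {{}}"
proof -
  have "C = {}" if "C \<in> F" for C using assms that by (auto simp: vars_def)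
  then show ?thesis using MU_nonempty[OF assms(1)] by auto
qed

lemma delta_trivial: "delta {{}} = 1"
  by (simp add: delta_def vars_def)

section \<open>Setting a literal to true\<close>

definition split :: "lit set set \<Rightarrow> lit \<Rightarrow> lit set set" where
  "split F x = (\<lambda>C. C - {comp x}) ` {C\<in>F. x \<notin> C}"

text \<open>Clauses that become equal differ at most in \<open>comp x\<close>, so one contains the
  other. Hence no clauses merge, and clauses and degrees of the split can be counted in
  \<open>F\<close>.\<close>

lemma split_inj:
  assumes "MU F"
  shows "inj_on (\<lambda>C. C - {comp x}) {C\<in>F. x \<notin> C}"
proof (rule inj_onI)
  fix C D assume *: "C \<in> {C\<in>F. x \<notin> C}" "D \<in> {C\<in>F. x \<notin> C}" "C - {comp x} = D - {comp x}"
  then have "C \<subseteq> D \<or> D \<subseteq> C" by blast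
  then show "C = D" using MU_subset_eq[OF assms] * by blast
qed

lemma card_split:
  assumes "MU F"
  shows "card (split F x) + ldeg F x = card F"
proof -
  have "card (split F x) = card {C\<in>F. x \<notin> C}"
    unfolding split_def by (rule card_image[OF split_inj[OF assms]])
  moreover have "card F = card {C\<in>F. x \<notin> C} + card {C\<in>F. x \<in> C}"
    using MU_finite[OF assms] by (subst card_Un_disjoint[symmetric]) (auto intro: arg_cong[of _ _ card])
  ultimately show ?thesis by (simp add: ldeg_def)
qed

lemma split_is_clause_set: "is_clause_set F \<Longrightarrow> is_clause_set (split F x)"
  by (auto simp: is_clause_set_def split_def is_clause_def)

lemma split_no_var: "C \<in> split F x \<Longrightarrow> var_of x \<notin> var_of ` C"
  by (auto simp: split_def var_of_eq_iff)

lemma split_sat_by: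
  assumes "sat_by \<phi> (split F x)"
  shows "sat_by (set_lit \<phi> x) F"
  unfolding sat_by_def
proof
  fix C assume "C \<in> F"
  show "\<exists>z\<in>C. lit_true (set_lit \<phi> x) z"
  proof (cases "x \<in> C")
    case False
    then obtain z where "z \<in> C" "z \<noteq> comp x" "lit_true \<phi> z"
      using assms \<open>C \<in> F\<close> by (auto simp: sat_by_def split_def)
    then show ?thesis by (auto simp: lit_true_set_lit)
  qed (auto simp: lit_true_set_lit)
qed

lemma ldeg_split:
  assumes "MU F" "var_of z \<noteq> var_of x"
  shows "ldeg F z = ldeg (split F x) z + card {C\<in>F. x \<in> C \<and> z \<in> C}"
proof -
  have "{C \<in> split F x. z \<in> C} = (\<lambda>C. C - {comp x}) ` {C\<in>F. x \<notin> C \<and> z \<in> C}"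
    using assms(2) by (auto simp: split_def)
  then have "ldeg (split F x) z = card {C\<in>F. x \<notin> C \<and> z \<in> C}"
    unfolding ldeg_def
    by (simp, intro card_image inj_on_subset[OF split_inj[OF assms(1)]]) auto
  moreover have "{C\<in>F. z \<in> C} = {C\<in>F. x \<notin> C \<and> z \<in> C} \<union> {C\<in>F. x \<in> C \<and> z \<in> C}" by auto
  then have "ldeg F z = card {C\<in>F. x \<notin> C \<and> z \<in> C} + card {C\<in>F. x \<in> C \<and> z \<in> C}"
    unfolding ldeg_def using MU_finite[OF assms(1)]
    by (simp, subst card_Un_disjoint) auto
  ultimately show ?thesis by simp
qed

lemma vdeg_split:
  assumes "MU F" "w \<noteq> var_of x"
  shows "vdeg F w = vdeg (split F x) w + card {C\<in>F. x \<in> C \<and> w \<in> var_of ` C}"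
proof -
  have "w \<in> var_of ` (C - {comp x}) \<longleftrightarrow> w \<in> var_of ` C" for C
    using assms(2) by auto
  then have "{C \<in> split F x. w \<in> var_of ` C} = (\<lambda>C. C - {comp x}) ` {C\<in>F. x \<notin> C \<and> w \<in> var_of ` C}"
    unfolding split_def by blast
  then have "vdeg (split F x) w = card {C\<in>F. x \<notin> C \<and> w \<in> var_of ` C}"
    unfolding vdeg_alt
    by (simp, intro card_image inj_on_subset[OF split_inj[OF assms(1)]]) auto
  moreover have "{C\<in>F. w \<in> var_of ` C} = {C\<in>F. x \<notin> C \<and> w \<in> var_of ` C} \<union> {C\<in>F. x \<in> C \<and> w \<in> var_of ` C}" by auto
  then have "vdeg F w = card {C\<in>F. x \<notin> C \<and> w \<in> var_of ` C} + card {C\<in>F. x \<in> C \<and> w \<in> var_of ` C}"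
    unfolding vdeg_alt using MU_finite[OF assms(1)]
    by (simp, subst card_Un_disjoint) auto
  ultimately show ?thesis by simp
qed

lemma vdeg_split_ge:
  assumes "MU F" "w \<noteq> var_of x"
  shows "vdeg F w \<le> vdeg (split F x) w + ldeg F x"
proof -
  have "card {C\<in>F. x \<in> C \<and> w \<in> var_of ` C} \<le> ldeg F x"
    unfolding ldeg_def using MU_finite[OF assms(1)] by (intro card_mono) auto
  then show ?thesis using vdeg_split[OF assms] by simp
qed

section \<open>Saturation\<close>

definition saturated :: "lit set set \<Rightarrow> bool" where
  "saturated F \<longleftrightarrow> MU F \<and> (\<forall>C\<in>F. \<forall>x. var_of x \<in> vars F \<longrightarrow> x \<notin> C \<longrightarrow> comp x \<notin> C
      \<longrightarrow> satisfiable (insert (insert x C) (F - {C})))"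

lemma saturated_MU: "saturated F \<Longrightarrow> MU F"
  by (simp add: saturated_def)

lemma saturated_witness:
  assumes "saturated F" "C \<in> F" "var_of x \<in> vars F" "x \<notin> C" "comp x \<notin> C"
  obtains \<phi> where "sat_by \<phi> (F - {C})" "\<And>z. z \<in> C \<Longrightarrow> \<not> lit_true \<phi> z" "lit_true \<phi> x"
proof -
  obtain \<phi> where \<phi>: "sat_by \<phi> (insert (insert x C) (F - {C}))"
    using assms by (auto simp: saturated_def satisfiable_iff)
  have "\<not> sat_by \<phi> F" using MU_unsat saturated_MU[OF assms(1)] by blast
  with \<phi> have "\<not> lit_true \<phi> z" if "z \<in> C" for z
    using that by (auto simp: sat_by_def)
  then show ?thesis using that[of \<phi>] \<phi> by (auto simp: sat_by_def)
qed

text \<open>The working form of saturation. If \<open>x\<close> were missing from \<open>C\<close>,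
  some assignment failing only at \<open>C\<close> would make \<open>x\<close> true: any such
  assignment if \<open>comp x\<close> is in \<open>C\<close>, and one given by saturation
  otherwise.\<close>

lemma saturated_mem:
  assumes "saturated F" "C \<in> F" "var_of x \<in> vars F"
    and imp: "\<And>\<phi>. sat_by \<phi> (F - {C}) \<Longrightarrow> (\<And>z. z \<in> C \<Longrightarrow> \<not> lit_true \<phi> z) \<Longrightarrow> \<not> lit_true \<phi> x"
  shows "x \<in> C"
proof (rule ccontr)
  assume x: "x \<notin> C"
  show False
  proof (cases "comp x \<in> C")
    case True
    obtain \<phi> where \<phi>: "sat_by \<phi> (F - {C})" "\<And>z. z \<in> C \<Longrightarrow> \<not> lit_true \<phi> z"
      using MU_witness saturated_MU[OF assms(1)] assms(2) by blast
    then show False using imp[OF \<phi>] True lit_true_comp by blast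
  next
    case False
    then show False using saturated_witness[OF assms(1-3) x] imp by metis
  qed
qed

text \<open>Minimality of the split needs, for each remaining clause \<open>C\<close>, an assignment
  failing only at \<open>C\<close> that makes \<open>x\<close> true. This is automatic if
  \<open>comp x\<close> is in \<open>C\<close>; otherwise it is what saturation provides.\<close>

lemma MU_split:
  assumes "saturated F" "var_of x \<in> vars F"
  shows "MU (split F x)"
proof -
  note MU = saturated_MU[OF assms(1)]
  have "\<not> satisfiable (split F x)"
    using split_sat_by MU_unsat[OF MU] by (auto simp: satisfiable_iff)
  moreover have "satisfiable (split F x - {D})" if "D \<in> split F x" for D
  proof -
    obtain C where C: "C \<in> F" "x \<notin> C" "D = C - {comp x}" using \<open>D \<in> split F x\<close> by (auto simp: split_def)
    obtain \<phi> where \<phi>: "sat_by \<phi> (F - {C})" "lit_true \<phi> x"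
    proof (cases "comp x \<in> C")
      case True
      then show ?thesis using MU_witness[OF MU C(1)] that lit_true_comp by metis
    next
      case False
      then show ?thesis using saturated_witness[OF assms(1) C(1) assms(2) C(2)] that by metis
    qed
    have "\<exists>z\<in>E. lit_true \<phi> z" if "E \<in> split F x - {D}" for E
    proof -
      obtain B where B: "B \<in> F" "x \<notin> B" "E = B - {comp x}" using \<open>E \<in> split F x - {D}\<close> by (auto simp: split_def)
      then have "B \<noteq> C" using C \<open>E \<in> split F x - {D}\<close> by auto
      then obtain z where "z \<in> B" "lit_true \<phi> z" using \<phi> B by (auto simp: sat_by_def)
      then have "z \<noteq> comp x" using \<phi>(2) by auto
      then show ?thesis using \<open>z \<in> B\<close> \<open>lit_true \<phi> z\<close> B(3) by blast
    qed
    then show ?thesis unfolding satisfiable_def by blast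
  qed
  ultimately show ?thesis
    using split_is_clause_set MU_clause_set[OF MU] by (auto simp: MU_def)
qed

lemma vars_split:
  assumes "MU F" and "\<And>w. w \<in> vars F \<Longrightarrow> w \<noteq> var_of x \<Longrightarrow> \<exists>C\<in>F. x \<notin> C \<and> w \<in> var_of ` C"
  shows "vars (split F x) = vars F - {var_of x}"
proof (intro equalityI subsetI)
  fix w assume "w \<in> vars (split F x)"
  then show "w \<in> vars F - {var_of x}"
    using split_no_var[of _ F x] by (fastforce simp: in_vars_iff split_def)
next
  fix w assume w: "w \<in> vars F - {var_of x}"
  then obtain C z where "C\<in>F" "x \<notin> C" "z \<in> C" "w = var_of z" using assms(2) by blast
  then show "w \<in> vars (split F x)"
    using w unfolding in_vars_iff split_def by (intro bexI[of _ "C - {comp x}"]) auto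
qed

lemma vars_split_deg:
  assumes "MU F" and "\<And>w. w \<in> vars F \<Longrightarrow> w \<noteq> var_of x \<Longrightarrow> ldeg F x < vdeg F w"
  shows "vars (split F x) = vars F - {var_of x}"
proof (rule vars_split[OF assms(1)])
  fix w assume w: "w \<in> vars F" "w \<noteq> var_of x"
  then have "0 < vdeg (split F x) w" using vdeg_split_ge[OF assms(1) w(2)] assms(2)[OF w] by simp
  then have "w \<in> vars (split F x)"
    using vdeg_pos_iff split_is_clause_set MU_clause_set assms(1) by blast
  then show "\<exists>C\<in>F. x \<notin> C \<and> w \<in> var_of ` C" by (auto simp: in_vars_iff split_def)
qed

lemma delta_split:
  assumes "MU F" "var_of x \<in> vars F" "vars (split F x) = vars F - {var_of x}"
  shows "delta (split F x) = delta F - int (ldeg F x) + 1"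
proof -
  have "card (vars F) > 0" using assms finite_vars MU_clause_set by (auto simp: card_gt_0_iff)
  then have "int (card (vars F - {var_of x})) = int (card (vars F)) - 1"
    using assms by (simp add: of_nat_diff)
  then show ?thesis using card_split[OF assms(1), of x] assms(3) by (simp add: delta_def)
qed

definition lits :: "nat set \<Rightarrow> lit set" where
  "lits V = {x. var_of x \<in> V}"

lemma finite_lits: "finite V \<Longrightarrow> finite (lits V)"
proof -
  assume "finite V"
  moreover have "lits V \<subseteq> Pos ` V \<union> Neg ` V"
  proof
    fix x assume "x \<in> lits V"
    then show "x \<in> Pos ` V \<union> Neg ` V" by (cases x) (auto simp: lits_def)
  qed
  ultimately show ?thesis by (meson finite_UnI finite_imageI finite_subset)
qed

text \<open>A longer clause is easier to satisfy, so the assignments witnessing the necessity of the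
  other clauses survive; only unsatisfiability has to be assumed.\<close>

lemma MU_add_literal:
  assumes "MU F" "C \<in> F" "var_of x \<in> vars F" "x \<notin> C" "comp x \<notin> C"
    and unsat: "\<not> satisfiable (insert (insert x C) (F - {C}))"
  shows "MU (insert (insert x C) (F - {C}))" "insert x C \<notin> F"
    "vars (insert (insert x C) (F - {C})) = vars F"
proof -
  have cl: "is_clause D" if "D \<in> F" for D
    using that MU_clause_set[OF assms(1)] by (auto simp: is_clause_set_def)
  show nin: "insert x C \<notin> F" using MU_subset_eq[OF assms(1,2), of "insert x C"] assms(4) by blast
  have "is_clause (insert x C)"
  proof (rule is_clauseI)
    show "finite (insert x C)" using cl[OF assms(2)] by (simp add: is_clause_def)
    show "comp z \<notin> insert x C" if "z \<in> insert x C" for z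
      using that assms(4,5) is_clause_comp[OF cl[OF assms(2)], of z] by auto
  qed
  then have "is_clause_set (insert (insert x C) (F - {C}))"
    using cl MU_finite[OF assms(1)] by (auto simp: is_clause_set_def)
  moreover have "satisfiable (insert (insert x C) (F - {C}) - {D})" if D: "D \<in> insert (insert x C) (F - {C})" for D
  proof (cases "D = insert x C")
    case True
    have "satisfiable (F - {C})" using assms by (auto simp: MU_def)
    then show ?thesis by (rule satisfiable_mono) (use True in auto)
  next
    case False
    then have "D \<in> F" "D \<noteq> C" using D by auto
    then obtain \<phi> where "sat_by \<phi> (F - {D})" using MU_witness[OF assms(1)] by blast
    then have "sat_by \<phi> (insert (insert x C) (F - {C}) - {D})"
      using \<open>D \<noteq> C\<close> assms(2) by (auto simp: sat_by_def)
    then show ?thesis by (auto simp: satisfiable_iff)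
  qed
  ultimately show "MU (insert (insert x C) (F - {C}))" using unsat by (auto simp: MU_def)
  show "vars (insert (insert x C) (F - {C})) = vars F"
    using assms(2,3) by (auto simp: vars_def)
qed

text \<open>Literals are added as long as unsatisfiability is preserved. The injection
  \<open>h\<close> follows each clause to its extension, so that occurrences can later be compared
  clause by clause.\<close>

lemma saturation:
  assumes "MU F"
  obtains h where "inj_on h F" "\<And>C. C \<in> F \<Longrightarrow> C \<subseteq> h C" "saturated (h ` F)" "vars (h ` F) = vars F"
proof -
  \<comment> \<open>The number of literal occurrences over \<open>vars F\<close> that are still
    missing; variables and number of clauses stay fixed, so each added literal lowers it.\<close>
  define m where "m = (\<lambda>F. card F * card (lits (vars F)) - (\<Sum>C\<in>F. card C))"
  have "\<exists>h. inj_on h F \<and> (\<forall>C\<in>F. C \<subseteq> h C) \<and> saturated (h ` F) \<and> vars (h ` F) = vars F"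
    using assms
  proof (induction "m F" arbitrary: F rule: less_induct)
    case less
    show ?case
    proof (cases "saturated F")
      case True
      then show ?thesis by (intro exI[of _ id]) auto
    next
      case False
      then obtain C x where *: "C \<in> F" "var_of x \<in> vars F" "x \<notin> C" "comp x \<notin> C"
          "\<not> satisfiable (insert (insert x C) (F - {C}))"
        using less.prems by (auto simp: saturated_def)
      define G where "G = insert (insert x C) (F - {C})"
      note G = MU_add_literal[OF less.prems *, folded G_def]
      have fin: "finite F" using MU_finite less.prems by blast
      have finC: "finite C" using *(1) MU_clause_set[OF less.prems] by (auto simp: is_clause_set_def is_clause_def)
      have card: "card G = card F" unfolding G_def using G(2) fin *(1)
        by (simp add: card_Suc_Diff1 del: card_Diff_insert card_Diff_singleton)
      have "(\<Sum>D\<in>G. card D) = card (insert x C) + (\<Sum>D\<in>F - {C}. card D)"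
        unfolding G_def using G(2) fin by simp
      also have "\<dots> = Suc (\<Sum>D\<in>F. card D)"
        using *(1,3) fin finC by (simp add: sum.remove)
      finally have sum: "(\<Sum>D\<in>G. card D) = Suc (\<Sum>D\<in>F. card D)" .
      have finl: "finite (lits (vars F))" using finite_lits finite_vars MU_clause_set less.prems by blast
      \<comment> \<open>The subtraction in \<open>m\<close> is truncated; this bound ensures that
        the difference for \<open>F\<close> is positive and really drops.\<close>
      have "(\<Sum>D\<in>G. card D) \<le> (\<Sum>D\<in>G. card (lits (vars F)))"
      proof (rule sum_mono)
        fix D assume "D \<in> G"
        then have "D \<subseteq> lits (vars G)" by (auto simp: vars_def lits_def)
        then show "card D \<le> card (lits (vars F))" using G(3) finl card_mono by metis
      qed
      then have "m G < m F" unfolding m_def using sum card G(3) by simp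
      then obtain h where h: "inj_on h G" "\<forall>D\<in>G. D \<subseteq> h D" "saturated (h ` G)" "vars (h ` G) = vars G"
        using less.hyps G(1) by blast
      define k where "k = h \<circ> id(C := insert x C)"
      have "(id(C := insert x C)) ` F = G" using *(1) by (auto simp: G_def)
      moreover have "inj_on (id(C := insert x C)) F" using G(2) by (auto simp: inj_on_def)
      ultimately have "inj_on k F" "k ` F = h ` G"
        unfolding k_def using h(1) by (metis comp_inj_on, metis image_comp)
      moreover have "\<forall>D\<in>F. D \<subseteq> k D" using h(2) by (auto simp: k_def G_def)
      ultimately show ?thesis using h(3,4) G(3) by metis
    qed
  qed
  then show ?thesis using that by blast
qed

lemma delta_image: "inj_on h F \<Longrightarrow> vars (h ` F) = vars F \<Longrightarrow> delta (h ` F) = delta F"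
  by (simp add: delta_def card_image)

text \<open>Extending clauses only adds occurrences. If the number of clauses with \<open>w\<close>
  does not grow, the clauses with \<open>w\<close> are the same before and after, which allows
  clauses found in a saturation to be carried back.\<close>

lemma vdeg_image:
  assumes "finite F" "inj_on h F" "\<And>C. C \<in> F \<Longrightarrow> C \<subseteq> h C"
  shows "vdeg F w \<le> vdeg (h ` F) w"
    and "vdeg (h ` F) w \<le> vdeg F w \<Longrightarrow> C \<in> F \<Longrightarrow> w \<in> var_of ` h C \<Longrightarrow> w \<in> var_of ` C"
proof -
  have "{D\<in>h ` F. w \<in> var_of ` D} = h ` {C\<in>F. w \<in> var_of ` h C}" by auto
  then have eq: "vdeg (h ` F) w = card {C\<in>F. w \<in> var_of ` h C}"
    unfolding vdeg_alt by (simp add: card_image inj_on_subset[OF assms(2)])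
  have sub: "{C\<in>F. w \<in> var_of ` C} \<subseteq> {C\<in>F. w \<in> var_of ` h C}" using assms(3) image_mono by blast
  have "card {C\<in>F. w \<in> var_of ` C} \<le> card {C\<in>F. w \<in> var_of ` h C}"
    using assms(1) sub by (intro card_mono) simp_all
  then show "vdeg F w \<le> vdeg (h ` F) w"
    unfolding eq by (simp only: vdeg_alt)
  assume "vdeg (h ` F) w \<le> vdeg F w" "C \<in> F" "w \<in> var_of ` h C"
  then have "card {C\<in>F. w \<in> var_of ` h C} \<le> card {C\<in>F. w \<in> var_of ` C}"
    unfolding eq by (simp only: vdeg_alt)
  then have "{C\<in>F. w \<in> var_of ` C} = {C\<in>F. w \<in> var_of ` h C}"
    using assms(1) sub by (intro card_seteq) simp_all
  with \<open>C \<in> F\<close> \<open>w \<in> var_of ` h C\<close> show "w \<in> var_of ` C" by auto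
qed

text \<open>Unlike \<open>minvdeg\<close>, this keeps its meaning when there are no variables, where
  \<open>Min\<close> is unspecified.\<close>

definition mindeg_ge :: "lit set set \<Rightarrow> nat \<Rightarrow> bool" where
  "mindeg_ge F m \<longleftrightarrow> (\<forall>w\<in>vars F. m \<le> vdeg F w)"

lemma mindeg_ge_mono: "mindeg_ge F m \<Longrightarrow> n \<le> m \<Longrightarrow> mindeg_ge F n"
  by (auto simp: mindeg_ge_def)

lemma saturation_mindeg:
  assumes "MU F" "mindeg_ge F m"
  obtains G where "saturated G" "delta G = delta F" "vars G = vars F" "mindeg_ge G m"
    "\<And>w. vdeg F w \<le> vdeg G w" "\<And>x. ldeg F x \<le> ldeg G x"
proof -
  obtain h where h: "inj_on h F" "\<And>C. C \<in> F \<Longrightarrow> C \<subseteq> h C" "saturated (h ` F)" "vars (h ` F) = vars F"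
    using saturation[OF assms(1)] by blast
  have fin: "finite F" using MU_finite assms by blast
  have v: "vdeg F w \<le> vdeg (h ` F) w" for w using vdeg_image(1)[OF fin h(1,2)] .
  have "ldeg F x \<le> ldeg (h ` F) x" for x
  proof -
    have "h ` {C\<in>F. x \<in> C} \<subseteq> {D\<in>h ` F. x \<in> D}" using h(2) by auto
    then have "card (h ` {C\<in>F. x \<in> C}) \<le> card {D\<in>h ` F. x \<in> D}" using fin by (intro card_mono) auto
    then show ?thesis unfolding ldeg_def by (simp add: card_image inj_on_subset[OF h(1)])
  qed
  moreover have "mindeg_ge (h ` F) m" using assms(2) v h(4) by (auto simp: mindeg_ge_def intro: order_trans)
  ultimately show ?thesis using that h(3,4) delta_image[OF h(1,4)] v by blast
qed

section \<open>Splitting saturated clause-sets\<close>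

text \<open>Otherwise some assignment fails only at \<open>D\<close> and makes a literal
  \<open>t\<close> of \<open>C\<close> true. Making \<open>l\<close> false repairs \<open>D\<close>
  through \<open>comp l\<close>, while \<open>t\<close> keeps \<open>C\<close> satisfied, and no
  other clause contains \<open>l\<close>.\<close>

lemma singular_subset:
  assumes "saturated F" "C \<in> F" "l \<in> C" "ldeg F l = 1" "D \<in> F" "comp l \<in> D"
  shows "C - {l} \<subseteq> D"
proof
  fix t assume t: "t \<in> C - {l}"
  note MU = saturated_MU[OF assms(1)]
  have only: "E = C" if "E \<in> F" "l \<in> E" for E
  proof -
    obtain B where "{D\<in>F. l \<in> D} = {B}" using assms(4) by (auto simp: ldeg_def card_1_singleton_iff)
    then have "E = B" "C = B" using assms(2,3) that by blast+
    then show ?thesis by simp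
  qed
  show "t \<in> D"
  proof (rule saturated_mem[OF assms(1,5)])
    show "var_of t \<in> vars F" using t assms(2) by (auto simp: vars_def)
    fix \<phi> assume \<phi>: "sat_by \<phi> (F - {D})" "\<And>z. z \<in> D \<Longrightarrow> \<not> lit_true \<phi> z"
    show "\<not> lit_true \<phi> t"
    proof
      assume tt: "lit_true \<phi> t"
      have "sat_by (set_lit \<phi> (comp l)) F"
        unfolding sat_by_def
      proof
        fix E assume E: "E \<in> F"
        show "\<exists>z\<in>E. lit_true (set_lit \<phi> (comp l)) z"
        proof (cases "E = C \<or> E = D")
          case True
          then show ?thesis
          proof
            assume "E = C"
            moreover have "lit_true (set_lit \<phi> (comp l)) t" using tt t by (auto simp: lit_true_set_lit)
            ultimately show ?thesis using t by auto
          next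
            assume "E = D"
            then show ?thesis using assms(6) by (auto simp: lit_true_set_lit)
          qed
        next
          case False
          then have "l \<notin> E" using only E by blast
          moreover obtain z where "z \<in> E" "lit_true \<phi> z" using \<phi>(1) E False unfolding sat_by_def by blast
          ultimately show ?thesis by (auto simp: lit_true_set_lit)
        qed
      qed
      then show False using MU_unsat[OF MU] by blast
    qed
  qed
qed

text \<open>A variable with a literal of one occurrence can be eliminated for free. Only the clause
  \<open>C\<close> disappears, and by \<open>singular_subset\<close> each further literal of
  \<open>C\<close> occurs in all clauses with the variable of \<open>l\<close>, at least
  \<open>m\<close> many. Since its complement occurs too, its variable has degree at least
  \<open>m + 1\<close> and can afford the loss.\<close>

lemma singular_split:
  assumes "saturated F" "ldeg F l = 1" "mindeg_ge F m" "var_of l \<in> vars F"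
  shows "MU (split F l)" "delta (split F l) = delta F" "vars (split F l) = vars F - {var_of l}"
    "mindeg_ge (split F l) m"
proof -
  note MU = saturated_MU[OF assms(1)]
  note CS = MU_clause_set[OF MU]
  obtain C where C: "{D\<in>F. l \<in> D} = {C}"
    using assms(2) by (auto simp: ldeg_def card_1_singleton_iff)
  then have CF: "C \<in> F" "l \<in> C" by auto
  show "MU (split F l)" using MU_split assms by blast
  have deg: "m \<le> vdeg (split F l) w \<and> w \<in> vars (split F l)" if w: "w \<in> vars F" "w \<noteq> var_of l" for w
  proof (cases "w \<in> var_of ` C")
    case False
    then have "{D \<in> F. l \<in> D \<and> w \<in> var_of ` D} = {}" using C by blast
    then have "vdeg (split F l) w = vdeg F w" using vdeg_split[OF MU w(2)] by (simp only: card.empty)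
    then show ?thesis using assms(3) w(1) vdeg_pos_iff[OF CS] vdeg_pos_iff[OF split_is_clause_set[OF CS]]
      by (metis mindeg_ge_def)
  next
    case True
    then obtain t where t: "t \<in> C" "w = var_of t" by auto
    then have "t \<noteq> l" using w by auto
    have "{D\<in>F. comp l \<in> D} \<union> {C} \<subseteq> {D\<in>F. t \<in> D}"
      using singular_subset[OF assms(1) CF assms(2)] t \<open>t \<noteq> l\<close> CF(1) by auto
    then have "card ({D\<in>F. comp l \<in> D} \<union> {C}) \<le> ldeg F t"
      unfolding ldeg_def using MU_finite[OF MU] by (intro card_mono) auto
    moreover have "C \<notin> {D\<in>F. comp l \<in> D}" using MU_comp[OF MU CF] by auto
    ultimately have "Suc (ldeg F (comp l)) \<le> ldeg F t" using MU_finite[OF MU] by (simp add: ldeg_def)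
    moreover have "0 < ldeg F (comp t)" using MU_ldeg_pos[OF MU] w(1) t(2) by simp
    moreover have "m \<le> vdeg F (var_of l)" using assms(3,4) by (auto simp: mindeg_ge_def)
    ultimately have "Suc m \<le> vdeg F w" "2 \<le> vdeg F w" using vdeg_ldeg[OF CS, of l] vdeg_ldeg[OF CS, of t] assms(2) t(2) by auto
    then have "m \<le> vdeg (split F l) w" "0 < vdeg (split F l) w"
      using vdeg_split_ge[OF MU w(2)] assms(2) by auto
    then show ?thesis using vdeg_pos_iff[OF split_is_clause_set[OF CS]] by blast
  qed
  show vars: "vars (split F l) = vars F - {var_of l}"
  proof (rule vars_split[OF MU])
    fix w assume "w \<in> vars F" "w \<noteq> var_of l"
    then have "w \<in> vars (split F l)" using deg by blast
    then show "\<exists>C\<in>F. l \<notin> C \<and> w \<in> var_of ` C" by (auto simp: in_vars_iff split_def)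
  qed
  show "mindeg_ge (split F l) m" using deg vars by (auto simp: mindeg_ge_def)
  show "delta (split F l) = delta F" using delta_split[OF MU assms(4) vars] assms(2) by simp
qed

lemma degree_split:
  assumes "saturated F" "var_of x \<in> vars F" "\<And>w. w \<in> vars F \<Longrightarrow> w \<noteq> var_of x \<Longrightarrow> m + ldeg F x \<le> vdeg F w"
    "0 < m"
  shows "MU (split F x)" "delta (split F x) = delta F - int (ldeg F x) + 1"
    "vars (split F x) = vars F - {var_of x}" "mindeg_ge (split F x) m"
proof -
  note MU = saturated_MU[OF assms(1)]
  show "MU (split F x)" using MU_split assms by blast
  show v: "vars (split F x) = vars F - {var_of x}"
    using assms(3,4) by (intro vars_split_deg[OF MU]) force
  then show "delta (split F x) = delta F - int (ldeg F x) + 1"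
    using delta_split MU assms(2) by blast
  show "mindeg_ge (split F x) m"
    unfolding mindeg_ge_def v using assms(3) vdeg_split_ge[OF MU] by fastforce
qed

text \<open>At minimal degree, \<open>m - ldeg F x\<close> is the number of occurrences of
  \<open>comp x\<close>, hence positive, so no further variable can disappear.\<close>

lemma min_degree_split:
  assumes "saturated F" "var_of x \<in> vars F" "mindeg_ge F m" "vdeg F (var_of x) = m"
  shows "MU (split F x)" "delta (split F x) = delta F - int (ldeg F x) + 1"
    "vars (split F x) = vars F - {var_of x}" "mindeg_ge (split F x) (m - ldeg F x)"
proof -
  note MU = saturated_MU[OF assms(1)]
  have "m = ldeg F x + ldeg F (comp x)" "0 < ldeg F (comp x)"
    using assms(2,4) vdeg_ldeg[OF MU_clause_set[OF MU], of x] MU_ldeg_pos[OF MU, of "comp x"] by auto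
  then have "w \<in> vars F \<Longrightarrow> m - ldeg F x + ldeg F x \<le> vdeg F w" "0 < m - ldeg F x" for w
    using assms(3) by (auto simp: mindeg_ge_def)
  note degree_split[OF assms(1,2) this]
  then show "MU (split F x)" "delta (split F x) = delta F - int (ldeg F x) + 1"
    "vars (split F x) = vars F - {var_of x}" "mindeg_ge (split F x) (m - ldeg F x)" by blast+
qed

section \<open>Deficiency and minimal degree\<close>

lemma min_degree_var:
  assumes "MU F" "vars F \<noteq> {}"
  obtains x where "var_of x \<in> vars F" "mindeg_ge F (vdeg F (var_of x))"
proof -
  have "\<exists>w\<in>vars F. \<forall>u\<in>vars F. vdeg F w \<le> vdeg F u"
    using ex_min_if_finite[of "vdeg F ` vars F"] finite_vars[OF MU_clause_set[OF assms(1)]] assms(2)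
    by (metis (no_types, lifting) finite_imageI image_iff image_is_empty linorder_not_le)
  then show ?thesis using that vars_litE by (metis mindeg_ge_def)
qed

text \<open>This is Tarsi's lemma. Splitting a saturation at a variable of minimal degree removes
  that variable and does not raise the deficiency; without variables only the empty clause is
  left.\<close>

lemma delta_pos:
  assumes "MU F"
  shows "1 \<le> delta F"
  using assms
proof (induction "card (vars F)" arbitrary: F rule: less_induct)
  case less
  show ?case
  proof (cases "vars F = {}")
    case True
    then show ?thesis using MU_no_vars[OF less.prems] delta_trivial by simp
  next
    case False
    obtain G where G: "saturated G" "delta G = delta F" "vars G = vars F"
      using saturation_mindeg[OF less.prems, of 0] mindeg_ge_def by (metis zero_le)
    note MU = saturated_MU[OF G(1)]
    obtain x where x: "var_of x \<in> vars G" "mindeg_ge G (vdeg G (var_of x))"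
      using min_degree_var[OF MU] False G(3) by metis
    note s = min_degree_split[OF G(1) x refl]
    have "card (vars (split G x)) < card (vars F)"
      unfolding s(3) G(3)[symmetric] using x(1) finite_vars[OF MU_clause_set[OF MU]]
      by (intro psubset_card_mono) auto
    then have "1 \<le> delta (split G x)" using less.hyps s(1) by blast
    moreover have "0 < ldeg G x" using MU_ldeg_pos[OF MU x(1)] .
    ultimately show ?thesis using s(2) G(2) by simp
  qed
qed

lemma vars_nonempty: "MU F \<Longrightarrow> 2 \<le> delta F \<Longrightarrow> vars F \<noteq> {}"
  using MU_no_vars[of F] delta_trivial by auto

text \<open>Over one variable only the two unit clauses are possible. Consequently a split from
  deficiency at least 2 keeps a variable, which the degree bounds require.\<close>

lemma single_var_delta:
  assumes "MU F" "vars F = {v}"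
  shows "delta F \<le> 1"
proof -
  have "C \<in> {{Pos v}, {Neg v}}" if C: "C \<in> F" for C
  proof -
    have "C \<noteq> {}" using MU_empty_clause[OF assms(1)] C assms(2) by (auto simp: vars_def)
    moreover have "C \<subseteq> {Pos v, Neg v}"
    proof
      fix x assume "x \<in> C"
      then have "var_of x = v" using C assms(2) by (auto simp: vars_def)
      then show "x \<in> {Pos v, Neg v}" by (cases x) auto
    qed
    moreover have "\<not> (Pos v \<in> C \<and> Neg v \<in> C)" using MU_comp[OF assms(1) C, of "Pos v"] by auto
    ultimately show ?thesis by blast
  qed
  then have "card F \<le> card {{Pos v}, {Neg v}}" by (intro card_mono) auto
  also have "\<dots> \<le> 2" by (simp add: card_insert_if)
  finally show ?thesis using assms(2) by (simp add: delta_def)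
qed

lemma split_vars_nonempty:
  assumes "MU F" "2 \<le> delta F" "vars (split F x) = vars F - {var_of x}" "var_of x \<in> vars F"
  shows "vars (split F x) \<noteq> {}"
proof
  assume "vars (split F x) = {}"
  then have "vars F = {var_of x}" using assms by auto
  then show False using single_var_delta[OF assms(1)] assms(2) by simp
qed

text \<open>Here \<open>e\<close> and \<open>e'\<close> are the numbers of occurrences of the two literals of a variable of
  minimal degree in a saturation of \<open>F\<close>; the first alternative accounts for \<open>e = 1\<close> or
  \<open>e' = 1\<close>.\<close>

lemma degree_step:
  assumes "MU F" "2 \<le> delta F" "mindeg_ge F m"
  shows "(\<exists>G. MU G \<and> delta G = delta F \<and> card (vars G) < card (vars F) \<and> mindeg_ge G m) \<or>
    (\<exists>e e' G G'. m \<le> e + e' \<and> 2 \<le> e \<and> e \<le> e' \<and>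
       MU G \<and> delta G = delta F - int e + 1 \<and> vars G \<noteq> {} \<and> mindeg_ge G e' \<and>
       MU G' \<and> delta G' = delta F - int e' + 1 \<and> vars G' \<noteq> {} \<and> mindeg_ge G' e)"
proof -
  obtain G where G: "saturated G" "delta G = delta F" "vars G = vars F" "mindeg_ge G m"
    using saturation_mindeg[OF assms(1,3)] by metis
  note MU = saturated_MU[OF G(1)]
  note CS = MU_clause_set[OF MU]
  have d: "2 \<le> delta G" using assms(2) G(2) by simp
  obtain x0 where x0: "var_of x0 \<in> vars G" "mindeg_ge G (vdeg G (var_of x0))"
    using min_degree_var[OF MU vars_nonempty[OF MU d]] .
  obtain x where x: "var_of x \<in> vars G" "mindeg_ge G (vdeg G (var_of x))" "ldeg G x \<le> ldeg G (comp x)"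
    using x0 that[of x0] that[of "comp x0"] by fastforce
  have x': "var_of (comp x) \<in> vars G" "mindeg_ge G (vdeg G (var_of (comp x)))" using x by auto
  have deg: "vdeg G (var_of x) = ldeg G x + ldeg G (comp x)" using vdeg_ldeg[OF CS] .
  show ?thesis
  proof (cases "ldeg G x = 1")
    case True
    note s = singular_split[OF G(1) True G(4) x(1)]
    have "card (vars (split G x)) < card (vars F)"
      unfolding s(3) G(3)[symmetric] using x(1) finite_vars[OF CS]
      by (intro psubset_card_mono) auto
    then show ?thesis using s G(2) by metis
  next
    case False
    then have "2 \<le> ldeg G x" using MU_ldeg_pos[OF MU x(1)] by simp
    moreover have "m \<le> ldeg G x + ldeg G (comp x)"
      using G(4) x(1) deg by (auto simp: mindeg_ge_def)
    moreover note s = min_degree_split[OF G(1) x(1,2) refl]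
    moreover note s' = min_degree_split[OF G(1) x' refl]
    moreover have "vdeg G (var_of x) - ldeg G x = ldeg G (comp x)" "vdeg G (var_of (comp x)) - ldeg G (comp x) = ldeg G x"
      using deg by simp_all
    moreover note split_vars_nonempty[OF MU d s(3) x(1)] split_vars_nonempty[OF MU d s'(3) x'(1)]
    ultimately show ?thesis using x(3) G(2) by metis
  qed
qed

definition degree_bound :: "int \<Rightarrow> nat \<Rightarrow> bool" where
  "degree_bound k b \<longleftrightarrow> (\<forall>F m. MU F \<longrightarrow> delta F = k \<longrightarrow> vars F \<noteq> {} \<longrightarrow> mindeg_ge F m \<longrightarrow> m \<le> b)"

lemma degree_boundD:
  "degree_bound k b \<Longrightarrow> MU F \<Longrightarrow> delta F = k \<Longrightarrow> vars F \<noteq> {} \<Longrightarrow> mindeg_ge F m \<Longrightarrow> m \<le> b"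
  unfolding degree_bound_def by blast

text \<open>Splitting lowers the deficiency by the number of occurrences minus 1, and it cannot fall
  below 1, so both literals of a variable of minimal degree occur only once.\<close>

lemma degree_bound_1: "degree_bound 1 2"
  unfolding degree_bound_def
proof (intro allI impI)
  fix F m assume F: "MU F" "delta F = 1" "vars F \<noteq> {}" "mindeg_ge F m"
  obtain G where G: "saturated G" "delta G = delta F" "vars G = vars F" "mindeg_ge G m"
    using saturation_mindeg[OF F(1,4)] by metis
  note MU = saturated_MU[OF G(1)]
  obtain x where x: "var_of x \<in> vars G" "mindeg_ge G (vdeg G (var_of x))"
    using min_degree_var[OF MU] G(3) F(3) by metis
  have x': "var_of (comp x) \<in> vars G" "mindeg_ge G (vdeg G (var_of (comp x)))" using x by auto
  have "ldeg G x \<le> 1" "ldeg G (comp x) \<le> 1"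
    using min_degree_split(1,2)[OF G(1) x refl] min_degree_split(1,2)[OF G(1) x' refl] delta_pos G(2) F(2) by fastforce+
  then have "vdeg G (var_of x) \<le> 2" using vdeg_ldeg[OF MU_clause_set[OF MU], of x] by simp
  then show "m \<le> 2" using G(4) x(1) by (auto simp: mindeg_ge_def)
qed

text \<open>The first alternative of \<open>degree_step\<close> is absorbed by induction on the
  number of variables. What remains to be refuted is a pair of literal degrees with sum above
  \<open>b\<close>.\<close>

lemma degree_bound_step:
  assumes "2 \<le> k"
    and "\<And>e e' G G'. b < e + e' \<Longrightarrow> 2 \<le> e \<Longrightarrow> e \<le> e' \<Longrightarrow>
       MU G \<Longrightarrow> delta G = k - int e + 1 \<Longrightarrow> vars G \<noteq> {} \<Longrightarrow> mindeg_ge G e' \<Longrightarrow>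
       MU G' \<Longrightarrow> delta G' = k - int e' + 1 \<Longrightarrow> vars G' \<noteq> {} \<Longrightarrow> mindeg_ge G' e \<Longrightarrow> False"
  shows "degree_bound k b"
  unfolding degree_bound_def
proof (intro allI impI)
  fix F m assume "MU F" "delta F = k" "vars F \<noteq> {}" "mindeg_ge F m"
  then show "m \<le> b"
  proof (induction "card (vars F)" arbitrary: F rule: less_induct)
    case less
    have d: "2 \<le> delta F" using less.prems assms(1) by simp
    from degree_step[OF less.prems(1) d less.prems(4)] show ?case
    proof (elim disjE exE conjE)
      fix G assume "MU G" "delta G = delta F" "card (vars G) < card (vars F)" "mindeg_ge G m"
      then show ?thesis using less.hyps[of G] less.prems(2) vars_nonempty[of G] d by simp
    next
      fix e e' G G' assume "m \<le> e + e'" "2 \<le> e" "e \<le> e'"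
        "MU G" "delta G = delta F - int e + 1" "vars G \<noteq> {}" "mindeg_ge G e'"
        "MU G'" "delta G' = delta F - int e' + 1" "vars G' \<noteq> {}" "mindeg_ge G' e"
      then show ?thesis using assms(2)[of e e' G G'] less.prems(2) by (cases "b < e + e'") simp_all
    qed
  qed
qed

text \<open>The split at the more frequent literal suffices: positivity of its deficiency
  \<open>k - e' + 1\<close> bounds \<open>e'\<close> by \<open>k\<close>, and its minimal degree is
  at least \<open>e\<close>, against a bound already known for smaller deficiency.\<close>

lemma degree_bounds: "degree_bound 2 4" "degree_bound 3 5" "degree_bound 4 6" "degree_bound 5 8" "degree_bound 6 9"
proof -
  show b2: "degree_bound 2 4"
  proof (rule degree_bound_step)
    fix e e' :: nat and G G' assume *: "4 < e + e'" "2 \<le> e" "e \<le> e'" "MU G'" "delta G' = 2 - int e' + 1"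
    then show False using delta_pos[OF *(4)] by simp
  qed simp
  have aux: False if "degree_bound k b" "MU G" "delta G = k" "vars G \<noteq> {}" "mindeg_ge G m" "b < m" for k b G m
    using degree_boundD[OF that(1-5)] that(6) by simp
  show "degree_bound 3 5"
  proof (rule degree_bound_step)
    fix e e' :: nat and G G'
    assume *: "5 < e + e'" "2 \<le> e" "e \<le> e'" "MU G'" "delta G' = 3 - int e' + 1" "vars G' \<noteq> {}" "mindeg_ge G' e"
    have "e' = 3" "e = 3" using delta_pos[OF *(4)] * by simp_all
    then show False using aux[OF degree_bound_1 *(4) _ *(6,7)] * by simp
  qed simp
  show "degree_bound 4 6"
  proof (rule degree_bound_step)
    fix e e' :: nat and G G'
    assume *: "6 < e + e'" "2 \<le> e" "e \<le> e'" "MU G'" "delta G' = 4 - int e' + 1" "vars G' \<noteq> {}" "mindeg_ge G' e"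
    have "e' = 4" "3 \<le> e" using delta_pos[OF *(4)] * by simp_all
    then show False using aux[OF degree_bound_1 *(4) _ *(6,7)] * by simp
  qed simp
  show "degree_bound 5 8"
  proof (rule degree_bound_step)
    fix e e' :: nat and G G'
    assume *: "8 < e + e'" "2 \<le> e" "e \<le> e'" "MU G'" "delta G' = 5 - int e' + 1" "vars G' \<noteq> {}" "mindeg_ge G' e"
    have "e' = 5" "3 \<le> e" using delta_pos[OF *(4)] * by simp_all
    then show False using aux[OF degree_bound_1 *(4) _ *(6,7)] * by simp
  qed simp
  show "degree_bound 6 9"
  proof (rule degree_bound_step)
    fix e e' :: nat and G G'
    assume *: "9 < e + e'" "2 \<le> e" "e \<le> e'" "MU G'" "delta G' = 6 - int e' + 1" "vars G' \<noteq> {}" "mindeg_ge G' e"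
    \<comment> \<open>Sum 9 cannot be excluded in this way: for \<open>e = 4\<close> and
      \<open>e' = 5\<close> the split has deficiency 2 and may have minimal degree 4.\<close>
    have "e' = 6 \<and> 3 \<le> e \<or> e' = 5 \<and> 5 \<le> e" using delta_pos[OF *(4)] * by auto
    then show False using aux[OF degree_bound_1 *(4) _ *(6,7)] aux[OF b2 *(4) _ *(6,7)] * by auto
  qed simp
qed

section \<open>Contraction of several clauses to one\<close>

text \<open>By \<open>unsat\<close> and \<open>crit\<close> an assignment of \<open>V\<close> can
  satisfy all clauses of \<open>T\<close> but one, the exception being free to choose, and never all
  of them. As \<open>V\<close> occurs only in \<open>T\<close>, the clauses of \<open>T\<close>
  together restrict the other variables exactly as the single clause \<open>Z\<close> does.\<close>

lemma contraction:
  fixes H T :: "lit set set" and V :: "nat set"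
  defines "Z \<equiv> {x \<in> \<Union>T. var_of x \<notin> V}"
  assumes MU: "MU H" and T: "T \<subseteq> H" and V: "V \<subseteq> vars H"
    and disj: "\<forall>C\<in>H - T. var_of ` C \<inter> V = {}"
    and unsat: "\<forall>\<psi>. \<exists>C\<in>T. \<forall>x\<in>C. var_of x \<in> V \<longrightarrow> \<not> lit_true \<psi> x"
    and crit: "\<forall>C\<in>T. \<exists>\<psi>. \<forall>D\<in>T - {C}. \<exists>x\<in>D. var_of x \<in> V \<and> lit_true \<psi> x"
  shows "MU (insert Z (H - T))" "Z \<notin> H - T" "vars (insert Z (H - T)) = vars H - V"
    "delta (insert Z (H - T)) = delta H - int (card T) + 1 + int (card V)"
proof -
  note CS = MU_clause_set[OF MU]
  have cl: "is_clause C" if "C \<in> H" for C using CS that by (auto simp: is_clause_set_def)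
  have fin: "finite H" "finite T" using MU_finite[OF MU] T finite_subset by auto
  have ns: "\<not> sat_by \<phi> (insert Z (H - T))" for \<phi>
  proof
    assume \<phi>: "sat_by \<phi> (insert Z (H - T))"
    then obtain z C where z: "z \<in> C" "C \<in> T" "var_of z \<notin> V" "lit_true \<phi> z"
      by (auto simp: sat_by_def Z_def)
    obtain \<psi> where \<psi>: "\<forall>D\<in>T - {C}. \<exists>x\<in>D. var_of x \<in> V \<and> lit_true \<psi> x" using crit z(2) by blast
    \<comment> \<open>Inside \<open>V\<close> all of \<open>T\<close> except \<open>C\<close> is
      satisfied; outside \<open>V\<close> the literal \<open>z\<close> takes care of
      \<open>C\<close>.\<close>
    define \<theta> where "\<theta> = (\<lambda>v. if v \<in> V then \<psi> v else \<phi> v)"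
    have \<theta>: "lit_true \<theta> x = (if var_of x \<in> V then lit_true \<psi> x else lit_true \<phi> x)" for x
      by (cases x) (auto simp: \<theta>_def)
    have "sat_by \<theta> H"
      unfolding sat_by_def
    proof
      fix D assume D: "D \<in> H"
      consider "D = C" | "D \<in> T - {C}" | "D \<in> H - T" using D by blast
      then show "\<exists>x\<in>D. lit_true \<theta> x"
      proof cases
        case 1
        then show ?thesis using z \<theta> by auto
      next
        case 2
        then show ?thesis using \<psi> \<theta> by metis
      next
        case 3
        then obtain x where "x \<in> D" "lit_true \<phi> x" using \<phi> by (auto simp: sat_by_def)
        moreover have "var_of x \<notin> V" using disj 3 \<open>x \<in> D\<close> by blast
        ultimately show ?thesis using \<theta> by metis
      qed
    qed
    then show False using MU_unsat[OF MU] by blast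
  qed
  \<comment> \<open>\<open>T\<close> is nonempty, so some assignment satisfies \<open>H - T\<close>.
    Since the contraction is unsatisfiable, this assignment falsifies \<open>Z\<close>; hence
    \<open>Z\<close> is new and has no complementary pair.\<close>
  obtain C0 where C0: "C0 \<in> T" using unsat by blast
  obtain \<phi>0 where "sat_by \<phi>0 (H - {C0})" using MU_witness[OF MU] C0 T by blast
  then have \<phi>0: "sat_by \<phi>0 (H - T)" using C0 by (auto simp: sat_by_def)
  show Z: "Z \<notin> H - T" using ns[of \<phi>0] \<phi>0 by (metis insert_absorb)
  have "is_clause Z"
  proof (rule is_clauseI)
    have "Z \<subseteq> \<Union>T" by (auto simp: Z_def)
    moreover have "finite (\<Union>T)" using fin cl T by (auto simp: is_clause_def)
    ultimately show "finite Z" by (rule finite_subset)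
    show "comp z \<notin> Z" if "z \<in> Z" for z
    proof
      assume "comp z \<in> Z"
      then have "\<exists>x\<in>Z. lit_true \<phi>0 x" using that lit_true_comp by blast
      then show False using ns[of \<phi>0] \<phi>0 by (auto simp: sat_by_def)
    qed
  qed
  moreover have "satisfiable (insert Z (H - T) - {D})" if D: "D \<in> insert Z (H - T)" for D
  proof (cases "D = Z")
    case True
    then show ?thesis using \<phi>0 Z by (auto simp: satisfiable_iff)
  next
    case False
    then have D: "D \<in> H" "D \<notin> T" using D by auto
    obtain \<phi> where \<phi>: "sat_by \<phi> (H - {D})" using MU_witness[OF MU D(1)] by blast
    obtain C where C: "C \<in> T" "\<forall>x\<in>C. var_of x \<in> V \<longrightarrow> \<not> lit_true \<phi> x" using unsat by blast
    have "C \<in> H - {D}" using C D T by auto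
    then obtain x where "x \<in> C" "lit_true \<phi> x" using \<phi> by (auto simp: sat_by_def)
    then have "\<exists>x\<in>Z. lit_true \<phi> x" using C by (auto simp: Z_def)
    then have "sat_by \<phi> (insert Z (H - T) - {D})" using \<phi> by (auto simp: sat_by_def)
    then show ?thesis by (auto simp: satisfiable_iff)
  qed
  ultimately show "MU (insert Z (H - T))"
    using ns cl fin by (auto simp: MU_def is_clause_set_def satisfiable_iff)
  show v: "vars (insert Z (H - T)) = vars H - V"
  proof (intro equalityI subsetI)
    fix w assume "w \<in> vars (insert Z (H - T))"
    then obtain x C where x: "w = var_of x" "x \<in> C" "C \<in> insert Z (H - T)" by (auto simp: in_vars_iff)
    show "w \<in> vars H - V"
    proof (cases "C = Z")
      case True
      then show ?thesis using x T by (auto simp: Z_def vars_def)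
    next
      case False
      then have "C \<in> H - T" using x by simp
      then show ?thesis using disj x by (auto simp: vars_def)
    qed
  next
    fix w assume "w \<in> vars H - V"
    then obtain x C where x: "w = var_of x" "x \<in> C" "C \<in> H" "var_of x \<notin> V" by (auto simp: in_vars_iff)
    show "w \<in> vars (insert Z (H - T))"
    proof (cases "C \<in> T")
      case True
      then have "x \<in> Z" using x by (auto simp: Z_def)
      then show ?thesis using x by (auto simp: vars_def)
    qed (use x in \<open>auto simp: vars_def\<close>)
  qed
  have "card (H - T) = card H - card T" "card T \<le> card H" "card (vars H - V) = card (vars H) - card V"
      "card V \<le> card (vars H)"
    using T V fin finite_vars[OF CS] by (auto simp: card_Diff_subset finite_subset card_mono)
  then show "delta (insert Z (H - T)) = delta H - int (card T) + 1 + int (card V)"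
    using Z fin unfolding delta_def v by (simp add: of_nat_diff)
qed

lemma contraction_vdeg:
  assumes "finite H" "Z \<notin> H - T"
  shows "vdeg (insert Z (H - T)) q = card {C\<in>H - T. q \<in> var_of ` C} + (if q \<in> var_of ` Z then 1 else 0)"
proof -
  have "{C\<in>insert Z (H - T). q \<in> var_of ` C} = (if q \<in> var_of ` Z then {Z} else {}) \<union> {C\<in>H - T. q \<in> var_of ` C}"
    by auto
  moreover have "Z \<notin> {C\<in>H - T. q \<in> var_of ` C}" "finite {C\<in>H - T. q \<in> var_of ` C}" using assms by auto
  ultimately show ?thesis unfolding vdeg_alt by (cases "q \<in> var_of ` Z") (simp_all only: if_True if_False card_insert_disjoint insert_is_Un[symmetric] Un_empty_left, simp)
qed

section \<open>The structure of deficiency 1\<close>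

text \<open>Degree bound 2 yields a variable occurring once in each sign. Contracting its two
  clauses is resolution on \<open>w\<close>; the deficiency stays 1 and a variable disappears, which
  is the basis for induction.\<close>

lemma MU1_contraction:
  assumes "MU H" "delta H = 1" "vars H \<noteq> {}"
  obtains w A B H' where "\<And>C. C \<in> H \<Longrightarrow> w \<in> C \<Longrightarrow> C = A" "\<And>C. C \<in> H \<Longrightarrow> comp w \<in> C \<Longrightarrow> C = B"
    "vdeg H (var_of w) = 2"
    "A \<in> H" "B \<in> H" "w \<in> A" "comp w \<in> B"
    "H' = insert (A \<union> B - {w, comp w}) (H - {A, B})"
    "MU H'" "delta H' = 1" "card (vars H') < card (vars H)" "vars H' = vars H - {var_of w}"
    "\<And>q. q \<notin> var_of ` (A \<union> B) \<Longrightarrow> vdeg H' q = vdeg H q"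
proof -
  note CS = MU_clause_set[OF assms(1)]
  have "\<not> mindeg_ge H 3" using degree_boundD[OF degree_bound_1 assms, of 3] by auto
  then obtain v where v: "v \<in> vars H" "vdeg H v < 3" by (auto simp: mindeg_ge_def)
  then obtain w where w: "var_of w = v" using vars_litE by blast
  have "0 < ldeg H w" "0 < ldeg H (comp w)" using MU_ldeg_pos[OF assms(1)] v(1) w by auto
  moreover have "vdeg H (var_of w) = ldeg H w + ldeg H (comp w)" "vdeg H (var_of w) < 3"
    using vdeg_ldeg[OF CS, of w] v(2) w by simp_all
  ultimately have d: "ldeg H w = 1" "ldeg H (comp w) = 1" "vdeg H (var_of w) = 2" by linarith+
  obtain A where A: "{C\<in>H. w \<in> C} = {A}" using d(1) by (auto simp: ldeg_def card_1_singleton_iff)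
  obtain B where B: "{C\<in>H. comp w \<in> C} = {B}" using d(2) by (auto simp: ldeg_def card_1_singleton_iff)
  have AB: "A \<in> H" "w \<in> A" "B \<in> H" "comp w \<in> B" using A B by blast+
  have nc: "comp w \<notin> A" "w \<notin> B"
    using MU_comp[OF assms(1) AB(1,2)] MU_comp[OF assms(1) AB(3,4)] by auto
  then have "A \<noteq> B" using AB by auto
  have eq: "{x \<in> \<Union>{A, B}. var_of x \<notin> {var_of w}} = A \<union> B - {w, comp w}"
    by (auto simp: var_of_eq_iff)
  have disj: "var_of ` C \<inter> {var_of w} = {}" if "C \<in> H - {A, B}" for C
  proof -
    have "w \<notin> C" "comp w \<notin> C" using that A B by blast+
    then show ?thesis using var_of_image_iff[of w C] by auto
  qed
  have 1: "\<exists>C\<in>{A, B}. \<forall>x\<in>C. var_of x \<in> {var_of w} \<longrightarrow> \<not> lit_true \<psi> x" for \<psi>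
  proof (cases "lit_true \<psi> w")
    case True
    then have "\<forall>x\<in>B. var_of x \<in> {var_of w} \<longrightarrow> \<not> lit_true \<psi> x" using nc by (auto simp: var_of_eq_iff)
    then show ?thesis by blast
  next
    case False
    then have "\<forall>x\<in>A. var_of x \<in> {var_of w} \<longrightarrow> \<not> lit_true \<psi> x" using nc by (auto simp: var_of_eq_iff)
    then show ?thesis by blast
  qed
  have 2: "\<exists>\<psi>. \<forall>D\<in>{A, B} - {C}. \<exists>x\<in>D. var_of x \<in> {var_of w} \<and> lit_true \<psi> x" if "C \<in> {A, B}" for C
  proof (cases "C = A")
    case True
    then show ?thesis using AB
      by (intro exI[of _ "set_lit undefined (comp w)"]) (auto simp: lit_true_set_lit intro!: bexI[of _ "comp w"])
  next
    case False
    then show ?thesis using AB that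
      by (intro exI[of _ "set_lit undefined w"]) (auto simp: lit_true_set_lit intro!: bexI[of _ "w"])
  qed
  have V: "{var_of w} \<subseteq> vars H" using v w by simp
  have T: "{A, B} \<subseteq> H" using AB by simp
  have pre: "\<forall>C\<in>H - {A, B}. var_of ` C \<inter> {var_of w} = {}"
    "\<forall>\<psi>. \<exists>C\<in>{A, B}. \<forall>x\<in>C. var_of x \<in> {var_of w} \<longrightarrow> \<not> lit_true \<psi> x"
    "\<forall>C\<in>{A, B}. \<exists>\<psi>. \<forall>D\<in>{A, B} - {C}. \<exists>x\<in>D. var_of x \<in> {var_of w} \<and> lit_true \<psi> x"
    using disj 1 2 by blast+
  note c = contraction[OF assms(1) T V pre, unfolded eq]
  define H' where "H' = insert (A \<union> B - {w, comp w}) (H - {A, B})"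
  have "delta H' = 1" using c(4) assms(2) \<open>A \<noteq> B\<close> by (simp add: H'_def)
  moreover have "card (vars H') < card (vars H)"
    using V finite_vars[OF CS] by (intro psubset_card_mono) (auto simp only: H'_def c(3))
  moreover have "vdeg H' q = vdeg H q" if q: "q \<notin> var_of ` (A \<union> B)" for q
  proof -
    have "q \<notin> var_of ` (A \<union> B - {w, comp w})" using q by blast
    moreover have "{C\<in>H - {A, B}. q \<in> var_of ` C} = {C\<in>H. q \<in> var_of ` C}" using q by blast
    moreover have "vdeg H' q = card {C\<in>H - {A, B}. q \<in> var_of ` C} + (if q \<in> var_of ` (A \<union> B - {w, comp w}) then 1 else 0)"
      unfolding H'_def by (rule contraction_vdeg[OF MU_finite[OF assms(1)] c(2)])
    ultimately show ?thesis unfolding vdeg_alt[of H] by (simp only: if_False add_0_right)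
  qed
  moreover have "MU H'" "vars H' = vars H - {var_of w}" unfolding H'_def by (rule c)+
  moreover have "C = A" if "C \<in> H" "w \<in> C" for C using A that by blast
  moreover have "C = B" if "C \<in> H" "comp w \<in> C" for C using B that by blast
  moreover note AB d(3) H'_def
  ultimately show ?thesis by - (rule that[of w A B H']; assumption)
qed

text \<open>\<open>Z\<close> marks a clause to be avoided. If \<open>w\<close> occurs in
  \<open>Z\<close>, then \<open>Z\<close> is one of the two resolved clauses and the mark passes to
  the resolvent. A variable outside the resolvent and different from that of \<open>w\<close> lies
  outside both parents and keeps its degree.\<close>

lemma MU1_leaf:
  assumes "MU H" "delta H = 1" "vars H \<noteq> {}" "Z \<in> H"
  shows "(\<exists>q\<in>vars H. vdeg H q = 2 \<and> q \<notin> var_of ` Z) \<or> (\<exists>l. {l} \<in> H \<and> {l} \<noteq> Z)"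
  using assms
proof (induction "card (vars H)" arbitrary: H Z rule: less_induct)
  case less
  obtain w A B H' where only: "\<And>C. C \<in> H \<Longrightarrow> w \<in> C \<Longrightarrow> C = A" "\<And>C. C \<in> H \<Longrightarrow> comp w \<in> C \<Longrightarrow> C = B"
    and w: "vdeg H (var_of w) = 2"
    "A \<in> H" "B \<in> H" "w \<in> A" "comp w \<in> B"
    and H': "H' = insert (A \<union> B - {w, comp w}) (H - {A, B})"
    "MU H'" "delta H' = 1" "card (vars H') < card (vars H)" "vars H' = vars H - {var_of w}"
    and deg: "\<And>q. q \<notin> var_of ` (A \<union> B) \<Longrightarrow> vdeg H' q = vdeg H q"
    by (rule MU1_contraction[OF less.prems(1-3)]) blast
  define Z' where "Z' = A \<union> B - {w, comp w}"
  show ?case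
  proof (cases "var_of w \<in> var_of ` Z")
    case False
    moreover have "var_of w \<in> vars H" using w(2,4) by (auto simp: vars_def)
    ultimately show ?thesis using w(1) by blast
  next
    case True
    then have Z: "Z = A \<or> Z = B" using only less.prems(4) unfolding var_of_image_iff by blast
    show ?thesis
    proof (cases "vars H' = {}")
      case True
      then have "H' = {{}}" using MU_no_vars H'(2) by blast
      then have "A \<union> B \<subseteq> {w, comp w}" unfolding H'(1) by blast
      then have "A = {w}" "B = {comp w}"
        using MU_comp[OF less.prems(1) w(2,4)] MU_comp[OF less.prems(1) w(3,5)] w(4,5) by auto
      then show ?thesis using Z w(2,3) by (metis comp_neq(1) singleton_inject)
    next
      case False
      have "Z' \<in> H'" using H'(1) by (simp add: Z'_def)
      from less.hyps[OF H'(4,2,3) False this] show ?thesis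
      proof
        assume "\<exists>q\<in>vars H'. vdeg H' q = 2 \<and> q \<notin> var_of ` Z'"
        then obtain q where q: "q \<in> vars H'" "vdeg H' q = 2" "q \<notin> var_of ` Z'" by blast
        then have "q \<noteq> var_of w" "q \<in> vars H" using H'(5) by auto
        then have nin: "q \<notin> var_of ` (A \<union> B)" using q(3) unfolding Z'_def by auto
        then have "vdeg H q = 2" using deg q(2) by simp
        moreover have "q \<notin> var_of ` Z" using nin Z by auto
        ultimately show ?thesis using \<open>q \<in> vars H\<close> by blast
      next
        assume "\<exists>l. {l} \<in> H' \<and> {l} \<noteq> Z'"
        then obtain l where "{l} \<in> H - {A, B}" using H'(1) by (auto simp: Z'_def)
        then show ?thesis using Z by auto
      qed
    qed
  qed
qed

text \<open>One variable is that of the resolved literal \<open>w\<close>; the other comes from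
  \<open>MU1_leaf\<close> applied to the contraction with the resolvent marked, since no other unit
  clause can be present there.\<close>

lemma MU1_two_leaves:
  assumes "MU H" "delta H = 1" "vars H \<noteq> {}" "\<And>l. {l} \<notin> H"
  obtains q r where "q \<noteq> r" "q \<in> vars H" "r \<in> vars H" "vdeg H q = 2" "vdeg H r = 2"
proof -
  obtain w A B H' where only: "\<And>C. C \<in> H \<Longrightarrow> w \<in> C \<Longrightarrow> C = A" "\<And>C. C \<in> H \<Longrightarrow> comp w \<in> C \<Longrightarrow> C = B"
    and w: "vdeg H (var_of w) = 2"
    "A \<in> H" "B \<in> H" "w \<in> A" "comp w \<in> B"
    and H': "H' = insert (A \<union> B - {w, comp w}) (H - {A, B})"
    "MU H'" "delta H' = 1" "card (vars H') < card (vars H)" "vars H' = vars H - {var_of w}"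
    and deg: "\<And>q. q \<notin> var_of ` (A \<union> B) \<Longrightarrow> vdeg H' q = vdeg H q"
    by (rule MU1_contraction[OF assms(1-3)]) blast
  define Z' where "Z' = A \<union> B - {w, comp w}"
  have "vars H' \<noteq> {}"
  proof
    assume "vars H' = {}"
    then have "H' = {{}}" using MU_no_vars H'(2) by blast
    then have "A \<subseteq> {w, comp w}" unfolding H'(1) by blast
    then have "A = {w}" using MU_comp[OF assms(1) w(2,4)] w(4) by auto
    then show False using assms(4) w(2) by simp
  qed
  moreover have "Z' \<in> H'" using H'(1) by (simp add: Z'_def)
  moreover have "{l} \<in> H' \<Longrightarrow> {l} = Z'" for l using assms(4) H'(1) by (auto simp: Z'_def)
  ultimately obtain q where q: "q \<in> vars H'" "vdeg H' q = 2" "q \<notin> var_of ` Z'"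
    using MU1_leaf[OF H'(2,3)] by metis
  then have "q \<noteq> var_of w" "q \<in> vars H" using H'(5) by auto
  moreover from this have "q \<notin> var_of ` (A \<union> B)" using q(3) unfolding Z'_def by auto
  then have "vdeg H q = 2" using deg q(2) by simp
  moreover have "var_of w \<in> vars H" using w(2,4) by (auto simp: vars_def)
  ultimately show ?thesis using that w(1) by blast
qed

text \<open>If one of two clashes were on the resolved variable, the other would put a complementary
  pair into the resolvent. If neither is, both clashes survive in the contraction and induction
  applies.\<close>

lemma MU1_clash:
  assumes "MU H" "delta H = 1" "C \<in> H" "D \<in> H" "a \<in> C" "b \<in> C" "comp a \<in> D" "comp b \<in> D"
  shows "a = b"
  using assms
proof (induction "card (vars H)" arbitrary: H C D rule: less_induct)
  case less
  have "vars H \<noteq> {}" using less.prems by (auto simp: vars_def)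
  obtain w A B H' where only: "\<And>C. C \<in> H \<Longrightarrow> w \<in> C \<Longrightarrow> C = A" "\<And>C. C \<in> H \<Longrightarrow> comp w \<in> C \<Longrightarrow> C = B"
    and w: "vdeg H (var_of w) = 2"
    "A \<in> H" "B \<in> H" "w \<in> A" "comp w \<in> B"
    and H': "H' = insert (A \<union> B - {w, comp w}) (H - {A, B})"
    "MU H'" "delta H' = 1" "card (vars H') < card (vars H)" "vars H' = vars H - {var_of w}"
    by (rule MU1_contraction[OF less.prems(1,2) \<open>vars H \<noteq> {}\<close>]) blast
  define Z' where "Z' = A \<union> B - {w, comp w}"
  have Z': "Z' \<in> H'" using H'(1) by (simp add: Z'_def)
  have key: "d = c" if c: "var_of c = var_of w" "c \<in> C" "comp c \<in> D" and d: "d \<in> C" "comp d \<in> D" for c d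
  proof (rule ccontr)
    assume "d \<noteq> c"
    moreover have "d \<noteq> comp c" using MU_comp[OF less.prems(1,3) c(2)] d by auto
    ultimately have "var_of d \<noteq> var_of w" using c(1) by (metis var_of_eq_iff)
    then have "d \<notin> {w, comp w}" "comp d \<notin> {w, comp w}" by (auto simp: var_of_eq_iff)
    moreover have "c = w \<or> c = comp w" using c(1) by (simp add: var_of_eq_iff)
    then have "C \<in> {A, B}" "D \<in> {A, B}" using c(2,3) less.prems(3,4) only by auto
    ultimately have "d \<in> Z'" "comp d \<in> Z'" using d by (auto simp: Z'_def)
    then show False using MU_comp[OF H'(2) Z'] by blast
  qed
  show ?case
  proof (cases "var_of a = var_of w \<or> var_of b = var_of w")
    case True
    then show ?thesis using key[of a b] key[of b a] less.prems(5-8) by auto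
  next
    case False
    then have "a \<notin> {w, comp w}" "b \<notin> {w, comp w}" "comp a \<notin> {w, comp w}" "comp b \<notin> {w, comp w}"
      by (auto simp: var_of_eq_iff)
    moreover have "\<exists>E'\<in>H'. c \<in> E' \<and> d \<in> E'"
      if "E \<in> H" "c \<in> E" "d \<in> E" "c \<notin> {w, comp w}" "d \<notin> {w, comp w}" for E c d
    proof (cases "E \<in> {A, B}")
      case True
      then show ?thesis using that Z' unfolding Z'_def by (intro bexI[of _ Z']) (auto simp: Z'_def)
    next
      case False
      then show ?thesis using that H'(1) by blast
    qed
    ultimately obtain C' D' where "C' \<in> H'" "a \<in> C'" "b \<in> C'" "D' \<in> H'" "comp a \<in> D'" "comp b \<in> D'"
      using less.prems(3-8) by metis
    then show ?thesis using less.hyps[OF H'(4,2,3)] by blast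
  qed
qed

section \<open>Variables of degree 4 in deficiency 2\<close>

lemma card_2_clausesE:
  assumes "ldeg F x = 2"
  obtains C D where "C \<noteq> D" "{E\<in>F. x \<in> E} = {C, D}"
  using assms unfolding ldeg_def card_2_iff by blast

text \<open>The splits at both literals have deficiency 1, and a variable of degree 2 in such a
  split is a clash of the two removed clauses. If \<open>x\<close> were in no binary clause, the
  split at \<open>comp x\<close> would have no unit clause, hence two such variables; the two
  clauses with \<open>comp x\<close> would then clash twice in the split at \<open>x\<close>,
  against \<open>MU1_clash\<close>.\<close>

lemma MU2_core_saturated:
  assumes "saturated G" "delta G = 2" "mindeg_ge G 4"
    and x: "var_of x \<in> vars G" "vdeg G (var_of x) = 4"
  shows "\<exists>u C D. var_of u \<in> vars G \<and> vdeg G (var_of u) = 4 \<and> var_of u \<noteq> var_of x \<and>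
      {E\<in>G. x \<in> E} = {C, D} \<and> u \<in> C \<and> comp u \<in> D" (is ?A)
    and "(\<And>l. {l} \<notin> G) \<Longrightarrow> \<exists>q. {x, q} \<in> G \<and> q \<noteq> x" (is "PROP _ \<Longrightarrow> ?B")
proof -
  note MU = saturated_MU[OF assms(1)]
  note CS = MU_clause_set[OF MU]
  have x': "var_of (comp x) \<in> vars G" "vdeg G (var_of (comp x)) = 4" using x by auto
  \<comment> \<open>Three occurrences of a literal would leave deficiency at most 0.\<close>
  have two: "ldeg G z = 2" if z: "var_of z \<in> vars G" "vdeg G (var_of z) = 4" for z
  proof -
    have z': "var_of (comp z) \<in> vars G" "vdeg G (var_of (comp z)) = 4" using z by auto
    have "ldeg G z \<le> 2"
      using min_degree_split(1,2)[OF assms(1) z(1) assms(3) z(2)] delta_pos assms(2) by fastforce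
    moreover have "ldeg G (comp z) \<le> 2"
      using min_degree_split(1,2)[OF assms(1) z'(1) assms(3) z'(2)] delta_pos assms(2) by fastforce
    ultimately show ?thesis using z(2) vdeg_ldeg[OF CS, of z] by simp
  qed
  \<comment> \<open>Falling from degree at least 4 to 2 uses up both clauses with \<open>z\<close>,
    so \<open>q\<close> has degree 4 and occurs twice in each sign. Each sign keeps one occurrence
    in the split, so one removed clause contains \<open>q\<close> and the other
    \<open>comp q\<close>.\<close>
  have clash: "(q \<in> C \<and> comp q \<in> D \<or> comp q \<in> C \<and> q \<in> D) \<and> vdeg G (var_of q) = 4 \<and> var_of q \<in> vars G"
    if z: "var_of z \<in> vars G" "vdeg G (var_of z) = 4" and CD: "C \<noteq> D" "{E\<in>G. z \<in> E} = {C, D}"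
      and q: "var_of q \<in> vars (split G z)" "vdeg (split G z) (var_of q) = 2" for z q C D
  proof -
    note s = min_degree_split[OF assms(1) z(1) assms(3) z(2)]
    have nz: "var_of q \<noteq> var_of z" and qv: "var_of q \<in> vars G" using q(1) s(3) by auto
    have "4 \<le> vdeg G (var_of q)" using assms(3) qv by (auto simp: mindeg_ge_def)
    moreover have "vdeg G (var_of q) \<le> 4" using vdeg_split_ge[OF MU nz] q(2) two[OF z] by simp
    ultimately have q4: "vdeg G (var_of q) = 4" by simp
    have "0 < ldeg (split G z) q" "0 < ldeg (split G z) (comp q)" using MU_ldeg_pos[OF s(1)] q(1) by auto
    then have one: "ldeg (split G z) q = 1" "ldeg (split G z) (comp q) = 1"
      using vdeg_ldeg[OF MU_clause_set[OF s(1)], of q] q(2) by linarith+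
    have nz': "var_of (comp q) \<noteq> var_of z" using nz by simp
    have q4': "var_of (comp q) \<in> vars G" "vdeg G (var_of (comp q)) = 4" using q4 qv by auto
    have "card {E\<in>G. z \<in> E \<and> q \<in> E} = 1" "card {E\<in>G. z \<in> E \<and> comp q \<in> E} = 1"
      using ldeg_split[OF MU nz] ldeg_split[OF MU nz'] one two[OF qv q4] two[OF q4'] by simp_all
    then obtain E E' where "{E\<in>G. z \<in> E \<and> q \<in> E} = {E}" "{E\<in>G. z \<in> E \<and> comp q \<in> E} = {E'}"
      by (auto simp: card_1_singleton_iff)
    moreover have "{E\<in>G. z \<in> E \<and> p \<in> E} = {E \<in> {C, D}. p \<in> E}" for p using CD(2) by blast
    ultimately have E: "{E \<in> {C, D}. q \<in> E} = {E}" "{E \<in> {C, D}. comp q \<in> E} = {E'}" by simp_all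
    have "E \<in> {C, D}" "q \<in> E" "E' \<in> {C, D}" "comp q \<in> E'"
      using E[THEN equalityD2] by simp_all
    moreover from this have "E \<in> G" using CD(2) by auto
    ultimately have "E \<in> {C, D}" "q \<in> E" "E' \<in> {C, D}" "comp q \<in> E'" "E \<noteq> E'"
      using MU_comp[OF MU] by auto
    then show ?thesis using q4 qv by blast
  qed
  obtain C D where CD: "C \<noteq> D" "{E\<in>G. x \<in> E} = {C, D}" using card_2_clausesE[OF two[OF x]] .
  obtain C' D' where CD': "C' \<noteq> D'" "{E\<in>G. comp x \<in> E} = {C', D'}" using card_2_clausesE[OF two[OF x']] .
  have d1: "MU (split G z) \<and> delta (split G z) = 1 \<and> vars (split G z) \<noteq> {}" if z: "var_of z \<in> vars G" "vdeg G (var_of z) = 4" for z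
    using min_degree_split[OF assms(1) z(1) assms(3) z(2)] assms(2) two[OF z] split_vars_nonempty[OF MU _ _ z(1)] by simp
  show ?A
  proof -
    obtain w where w: "var_of w \<in> vars (split G x)" "vdeg (split G x) (var_of w) = 2"
      using MU1_contraction[of "split G x"] d1[OF x] by (metis Diff_empty Diff_insert0 less_irrefl)
    have "var_of w \<noteq> var_of x" using w(1) split_no_var[of _ G x] by (metis in_vars_iff)
    then show ?thesis using clash[OF x CD w] CD by (metis comp_comp var_of_comp)
  qed
  assume nounit: "\<And>l. {l} \<notin> G"
  show ?B
  proof (rule ccontr)
    assume no: "\<not> ?B"
    have "{l} \<notin> split G (comp x)" for l
    proof
      assume "{l} \<in> split G (comp x)"
      then obtain E where "E \<in> G" "E - {x} = {l}" by (auto simp: split_def)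
      then have "E = {l} \<or> E = {x, l}" "l \<noteq> x" by auto
      then show False using nounit no \<open>E \<in> G\<close> by auto
    qed
    then obtain q r where qr: "q \<noteq> r" "q \<in> vars (split G (comp x))" "r \<in> vars (split G (comp x))"
       "vdeg (split G (comp x)) q = 2" "vdeg (split G (comp x)) r = 2"
      using MU1_two_leaves[of "split G (comp x)"] d1[OF x'] by metis
    obtain a b where ab: "var_of a = q" "var_of b = r" using qr(2,3) vars_litE by metis
    have *: "var_of a \<in> vars (split G (comp x))" "vdeg (split G (comp x)) (var_of a) = 2"
        "var_of b \<in> vars (split G (comp x))" "vdeg (split G (comp x)) (var_of b) = 2" using ab qr by auto
    obtain a' where a': "var_of a' = q" "a' \<in> C'" "comp a' \<in> D'"
      using clash[OF x' CD' *(1,2)] ab(1) by (metis comp_comp var_of_comp)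
    obtain b' where b': "var_of b' = r" "b' \<in> C'" "comp b' \<in> D'"
      using clash[OF x' CD' *(3,4)] ab(2) by (metis comp_comp var_of_comp)
    have "q \<noteq> var_of x" "r \<noteq> var_of x" using qr(2,3) split_no_var[of _ G "comp x"] by (metis in_vars_iff var_of_comp)+
    then have ne: "a' \<noteq> comp x" "b' \<noteq> comp x" "comp a' \<noteq> comp x" "comp b' \<noteq> comp x" using a' b' by auto
    have C'D': "C' \<in> G" "comp x \<in> C'" "D' \<in> G" "comp x \<in> D'" using CD'(2) by blast+
    then have "x \<notin> C'" "x \<notin> D'" using MU_comp[OF MU, of _ "comp x"] by auto
    then have "C' - {comp x} \<in> split G x" "D' - {comp x} \<in> split G x" using C'D' by (auto simp: split_def)
    then have "a' = b'" using MU1_clash[of "split G x" "C' - {comp x}" "D' - {comp x}" a' b'] d1[OF x] a' b' ne by auto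
    then show False using qr(1) a'(1) b'(1) by simp
  qed
qed

text \<open>In the application \<open>K\<close> consists of the variables having degree 4 in some
  saturation of \<open>G\<close>. Recorded are those of their properties that can be carried back to
  the unsaturated \<open>G\<close>.\<close>

definition core :: "lit set set \<Rightarrow> nat set \<Rightarrow> bool" where
  "core G K \<longleftrightarrow> K \<subseteq> vars G \<and> K \<noteq> {} \<and> (\<forall>v\<in>K. vdeg G v = 4) \<and>
    (\<forall>x. var_of x \<in> K \<longrightarrow> (\<exists>u C D. var_of u \<in> K \<and> var_of u \<noteq> var_of x \<and>
      {E\<in>G. x \<in> E} = {C, D} \<and> u \<in> C \<and> comp u \<in> D)) \<and>
    ((\<forall>l. {l} \<notin> G) \<longrightarrow>
      (\<forall>x. var_of x \<in> K \<longrightarrow> (\<exists>q. var_of q \<in> K \<and> var_of q \<noteq> var_of x \<and> {x, q} \<in> G)))"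

lemma core_clauses:
  assumes "core G K" "var_of x \<in> K"
  obtains u C D where "var_of u \<in> K" "var_of u \<noteq> var_of x" "{E\<in>G. x \<in> E} = {C, D}" "u \<in> C" "comp u \<in> D"
proof -
  have "\<exists>u C D. var_of u \<in> K \<and> var_of u \<noteq> var_of x \<and> {E\<in>G. x \<in> E} = {C, D} \<and> u \<in> C \<and> comp u \<in> D"
    using assms(1)[unfolded core_def, THEN conjunct2, THEN conjunct2, THEN conjunct2, THEN conjunct1,
        THEN spec, of x] assms(2) by (rule mp)
  then show ?thesis by (elim exE conjE) (rule that)
qed

lemma core_binary:
  assumes "core G K" "var_of x \<in> K" "\<forall>l. {l} \<notin> G"
  obtains q where "var_of q \<in> K" "var_of q \<noteq> var_of x" "{x, q} \<in> G"
  using assms(1)[unfolded core_def, THEN conjunct2, THEN conjunct2, THEN conjunct2, THEN conjunct2] assms(2,3)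
  by blast

text \<open>A variable of degree 4 in the saturation has degree 4 in \<open>G\<close> already, so
  saturating has added no occurrence of it. The clauses found by \<open>MU2_core_saturated\<close>
  can therefore be pulled back along \<open>h\<close>.\<close>

lemma MU2_core:
  assumes "MU G" "delta G = 2" "mindeg_ge G 4"
  obtains K where "core G K"
proof -
  note fin = MU_finite[OF assms(1)]
  obtain h where h: "inj_on h G" "\<And>C. C \<in> G \<Longrightarrow> C \<subseteq> h C" "saturated (h ` G)" "vars (h ` G) = vars G"
    using saturation[OF assms(1)] by blast
  note MU' = saturated_MU[OF h(3)]
  have d: "delta (h ` G) = 2" using delta_image[OF h(1,4)] assms(2) by simp
  have up: "vdeg G w \<le> vdeg (h ` G) w" for w using vdeg_image(1)[OF fin h(1,2)] .
  then have m: "mindeg_ge (h ` G) 4" using assms(3) h(4) by (auto simp: mindeg_ge_def intro: order_trans)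
  define K where "K = {v \<in> vars G. vdeg (h ` G) v = 4}"
  have K4: "vdeg G v = 4" if "v \<in> K" for v
    using that up[of v] assms(3) by (auto simp: mindeg_ge_def K_def intro: antisym)
  have mem: "x \<in> C" if "var_of x \<in> K" "C \<in> G" "x \<in> h C" for x C
  proof -
    have "vdeg (h ` G) (var_of x) \<le> vdeg G (var_of x)" using K4 that(1) by (simp add: K_def)
    then have "var_of x \<in> var_of ` C" using vdeg_image(2)[OF fin h(1,2)] that(2,3) by blast
    moreover have "comp x \<notin> C" using MU_comp[OF MU' _ that(3)] h(2)[OF that(2)] that(2) by blast
    ultimately show ?thesis by (simp add: var_of_image_iff)
  qed
  have "K \<noteq> {}"
  proof
    assume "K = {}"
    then have "mindeg_ge (h ` G) 5" using m h(4) unfolding mindeg_ge_def K_def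
      by (metis (mono_tags, lifting) empty_Collect_eq le_neq_implies_less Suc_leI eval_nat_numeral(3))
    then show False using degree_boundD[OF degree_bounds(1) MU' d vars_nonempty[OF MU']] d by fastforce
  qed
  moreover have A: "\<exists>u C D. var_of u \<in> K \<and> var_of u \<noteq> var_of x \<and>
      {E\<in>G. x \<in> E} = {C, D} \<and> u \<in> C \<and> comp u \<in> D" if x: "var_of x \<in> K" for x
  proof -
    have "var_of x \<in> vars (h ` G)" "vdeg (h ` G) (var_of x) = 4" using x h(4) by (auto simp: K_def)
    from MU2_core_saturated(1)[OF h(3) d m this] obtain u C D where
      u: "var_of u \<in> K" "var_of u \<noteq> var_of x" and CD: "{E\<in>h ` G. x \<in> E} = {C, D}" "u \<in> C" "comp u \<in> D"
      using h(4) by (auto simp: K_def)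
    then have "C \<in> h ` G" "D \<in> h ` G" "x \<in> C" "x \<in> D" by blast+
    then obtain C' D' where C': "C' \<in> G" "C = h C'" "D' \<in> G" "D = h D'" by blast
    have "{E\<in>G. x \<in> E} = {C', D'}"
    proof (intro equalityI subsetI)
      fix E assume "E \<in> {E\<in>G. x \<in> E}"
      then have "E \<in> G" "h E \<in> {h C', h D'}" using CD(1) C' h(2) by blast+
      then show "E \<in> {C', D'}" using h(1) C' by (auto dest: inj_onD)
    next
      fix E assume "E \<in> {C', D'}"
      then show "E \<in> {E\<in>G. x \<in> E}" using mem[OF x] C' \<open>x \<in> C\<close> \<open>x \<in> D\<close> by auto
    qed
    moreover have "u \<in> C'" "comp u \<in> D'" using mem u(1) C' CD(2,3) by auto
    ultimately show ?thesis using u by blast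
  qed
  moreover have "\<exists>q. var_of q \<in> K \<and> var_of q \<noteq> var_of x \<and> {x, q} \<in> G"
    if nounit: "\<forall>l. {l} \<notin> G" and x: "var_of x \<in> K" for x
  proof -
    have "{} \<notin> G" using MU_empty_clause[OF assms(1)] delta_trivial assms(2) by auto
    have nounit': "{l} \<notin> h ` G" for l
      using h(2) nounit \<open>{} \<notin> G\<close> by (metis image_iff subset_singletonD)
    have "var_of x \<in> vars (h ` G)" "vdeg (h ` G) (var_of x) = 4" using x h(4) by (auto simp: K_def)
    from MU2_core_saturated(2)[OF h(3) d m this nounit'] obtain q E where
      q: "q \<noteq> x" "E \<in> G" "h E = {x, q}" by (metis image_iff)
    then have "E \<subseteq> {x, q}" using h(2) by auto
    then have E: "E = {x, q}" using nounit q(2) \<open>{} \<notin> G\<close> by (metis subset_insert_iff subset_singletonD insert_Diff_single insert_absorb)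
    \<comment> \<open>Every clause with \<open>x\<close> contains the variable of \<open>u\<close>,
      so the second literal of the binary clause lies over \<open>K\<close>.\<close>
    obtain u C D where u: "var_of u \<in> K" "var_of u \<noteq> var_of x" "{E\<in>G. x \<in> E} = {C, D}" "u \<in> C" "comp u \<in> D"
      using A[OF x] by blast
    moreover have "E \<in> {E\<in>G. x \<in> E}" using E q(2) by simp
    ultimately have "u \<in> E \<or> comp u \<in> E" by auto
    then have "var_of q = var_of u" using E u(2) by auto
    then show ?thesis using u(1,2) E q(2) by (intro exI[of _ q]) simp
  qed
  moreover have "K \<subseteq> vars G" by (auto simp: K_def)
  ultimately have "core G K" using K4 unfolding core_def
    by (intro conjI ballI allI impI) (assumption | blast)+
  then show ?thesis by (rule that)
qed

text \<open>The four clauses show all sign patterns of \<open>y\<close> and \<open>r\<close>, and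
  degree 4 keeps \<open>r\<close> out of all others, so \<open>contraction\<close> trades four
  clauses and two variables for one clause. Another variable occurring in the four clauses reappears
  in the new one, whence the truncated \<open>- 1\<close>.\<close>

lemma square_contraction:
  assumes MU: "MU G" and y: "{E\<in>G. y \<in> E} = {A, B}" "{E\<in>G. comp y \<in> E} = {A', B'}"
    and r: "r \<in> A" "comp r \<in> B" "r \<in> A'" "comp r \<in> B'" "vdeg G (var_of r) = 4" "var_of r \<noteq> var_of y"
  obtains H where "MU H" "delta H = delta G - 1" "vars H = vars G - {var_of y, var_of r}"
    "\<And>q. q \<notin> {var_of y, var_of r} \<Longrightarrow> vdeg G q \<le> vdeg H q + (card {C\<in>{A, B, A', B'}. q \<in> var_of ` C} - 1)"
proof -
  note fin = MU_finite[OF MU]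
  define T where "T = {A, B, A', B'}"
  define V where "V = {var_of y, var_of r}"
  have inG: "A \<in> G" "B \<in> G" "A' \<in> G" "B' \<in> G" "y \<in> A" "y \<in> B" "comp y \<in> A'" "comp y \<in> B'"
    using y[THEN equalityD2] by simp_all
  have nin: "comp y \<notin> A" "comp r \<notin> A" "comp y \<notin> B" "r \<notin> B" "y \<notin> A'" "comp r \<notin> A'" "y \<notin> B'" "r \<notin> B'"
    using MU_comp[OF MU inG(1,5)] MU_comp[OF MU inG(1) r(1)] MU_comp[OF MU inG(2,6)] MU_comp[OF MU inG(2) r(2)]
      MU_comp[OF MU inG(3,7)] MU_comp[OF MU inG(3) r(3)] MU_comp[OF MU inG(4,8)] MU_comp[OF MU inG(4) r(4)] by simp_all
  have ne: "A \<noteq> B" "A \<noteq> A'" "A \<noteq> B'" "B \<noteq> A'" "B \<noteq> B'" "A' \<noteq> B'"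
    using inG nin r by metis+
  then have c4: "card T = 4" by (simp add: T_def)
  have TG: "T \<subseteq> G" using inG by (simp add: T_def)
  have Ty: "E \<in> T" if "E \<in> G" "var_of y \<in> var_of ` E" for E
    using that y by (auto simp: T_def var_of_image_iff)
  have Tr: "E \<in> T" if E: "E \<in> G" "var_of r \<in> var_of ` E" for E
  proof -
    have "T \<subseteq> {E\<in>G. var_of r \<in> var_of ` E}" using TG r by (auto simp: T_def var_of_image_iff)
    moreover have "card {E\<in>G. var_of r \<in> var_of ` E} \<le> card T" using r(5) c4 by (simp add: vdeg_alt)
    ultimately have "T = {E\<in>G. var_of r \<in> var_of ` E}" using fin by (intro card_seteq) auto
    then show ?thesis using E by blast
  qed
  have VG: "V \<subseteq> vars G" using inG(1,5) r(1) by (auto simp: V_def vars_def)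
  have disj: "\<forall>C\<in>G - T. var_of ` C \<inter> V = {}" using Ty Tr by (auto simp: V_def)
  have inV: "var_of z \<in> V \<longleftrightarrow> z \<in> {y, comp y, r, comp r}" for z by (auto simp: V_def var_of_eq_iff)
  have unsat: "\<forall>\<psi>. \<exists>C\<in>T. \<forall>x\<in>C. var_of x \<in> V \<longrightarrow> \<not> lit_true \<psi> x"
  proof
    fix \<psi>
    have "\<exists>C\<in>T. \<forall>x\<in>{y, comp y, r, comp r} \<inter> C. \<not> lit_true \<psi> x"
      using nin by (cases "lit_true \<psi> y"; cases "lit_true \<psi> r") (auto simp: T_def)
    then show "\<exists>C\<in>T. \<forall>x\<in>C. var_of x \<in> V \<longrightarrow> \<not> lit_true \<psi> x" unfolding inV by blast
  qed
  have crit: "\<forall>C\<in>T. \<exists>\<psi>. \<forall>D\<in>T - {C}. \<exists>x\<in>D. var_of x \<in> V \<and> lit_true \<psi> x"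
  proof
    fix C assume C: "C \<in> T"
    have s: "lit_true (set_lit (set_lit undefined a) b) a \<and> lit_true (set_lit (set_lit undefined a) b) b"
      if "var_of a \<noteq> var_of b" for a b
      using that by (auto simp: lit_true_set_lit)
    have mem: "\<exists>x\<in>D. var_of x \<in> V \<and> lit_true \<psi> x" if "z \<in> D" "lit_true \<psi> z" "var_of z \<in> V" for D \<psi> z
      using that by blast
    have V: "var_of y \<in> V" "var_of r \<in> V" by (auto simp: V_def)
    have ex: "\<exists>\<psi>. \<forall>D\<in>T - {C}. \<exists>x\<in>D. var_of x \<in> V \<and> lit_true \<psi> x"
      if "var_of a = var_of y" "var_of b = var_of r" "\<And>D. D \<in> T - {C} \<Longrightarrow> a \<in> D \<or> b \<in> D" for a b
      using s[of a b] that r(6) V by (intro exI[of _ "set_lit (set_lit undefined a) b"]) (metis mem)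
    \<comment> \<open>The assignment that falsifies both literals of \<open>C\<close> over
      \<open>V\<close> satisfies the other three sign patterns.\<close>
    consider "C = A" | "C = B" | "C = A'" | "C = B'" using C by (auto simp: T_def)
    then show "\<exists>\<psi>. \<forall>D\<in>T - {C}. \<exists>x\<in>D. var_of x \<in> V \<and> lit_true \<psi> x"
    proof cases
      case 1 then show ?thesis using inG r by (intro ex[of "comp y" "comp r"]) (auto simp: T_def)
    next
      case 2 then show ?thesis using inG r by (intro ex[of "comp y" "r"]) (auto simp: T_def)
    next
      case 3 then show ?thesis using inG r by (intro ex[of "y" "comp r"]) (auto simp: T_def)
    next
      case 4 then show ?thesis using inG r by (intro ex[of "y" "r"]) (auto simp: T_def)
    qed
  qed
  define Z where "Z = {x \<in> \<Union>T. var_of x \<notin> V}"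
  define H where "H = insert Z (G - T)"
  note c = contraction[OF MU TG VG disj unsat crit, folded Z_def, folded H_def]
  have "delta H = delta G - 1" using c(4) c4 r(6) by (simp add: V_def)
  moreover have "vdeg G q \<le> vdeg H q + (card {C\<in>T. q \<in> var_of ` C} - 1)" if q: "q \<notin> V" for q
  proof -
    have "{C\<in>G. q \<in> var_of ` C} = {C\<in>G - T. q \<in> var_of ` C} \<union> {C\<in>T. q \<in> var_of ` C}" using TG by blast
    then have "vdeg G q = card ({C\<in>G - T. q \<in> var_of ` C} \<union> {C\<in>T. q \<in> var_of ` C})" by (simp only: vdeg_alt)
    also have "\<dots> = card {C\<in>G - T. q \<in> var_of ` C} + card {C\<in>T. q \<in> var_of ` C}"
      using fin finite_subset[OF TG fin] by (intro card_Un_disjoint) auto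
    finally have v: "vdeg G q = card {C\<in>G - T. q \<in> var_of ` C} + card {C\<in>T. q \<in> var_of ` C}" .
    have h: "vdeg H q = card {C\<in>G - T. q \<in> var_of ` C} + (if q \<in> var_of ` Z then 1 else 0)"
      unfolding H_def by (rule contraction_vdeg[OF fin c(2)])
    show ?thesis
    proof (cases "{C\<in>T. q \<in> var_of ` C} = {}")
      case True
      then have "card {C\<in>T. q \<in> var_of ` C} = 0" by (simp only: card.empty)
      then show ?thesis using v h by simp
    next
      case False
      then have "q \<in> var_of ` Z" using q by (auto simp: Z_def)
      then show ?thesis using v h by simp
    qed
  qed
  ultimately show ?thesis using that[of H] c(1,3) unfolding T_def V_def by blast
qed

section \<open>A minimal counterexample of deficiency 6\<close>

locale minimal_counterexample =
  fixes F
  assumes sat: "saturated F" and delta: "delta F = 6" and mindeg: "mindeg_ge F 9"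
    and minimal: "\<And>G. MU G \<Longrightarrow> delta G = 6 \<Longrightarrow> mindeg_ge G 9 \<Longrightarrow> card (vars F) \<le> card (vars G)"
begin

lemma MU: "MU F"
  using saturated_MU sat .

lemma CS: "is_clause_set F"
  using MU_clause_set MU .

lemma fin: "finite F"
  using MU_finite MU .

text \<open>Eliminating a literal with a single occurrence would give a counterexample with fewer
  variables.\<close>

lemma not_singular:
  assumes "var_of l \<in> vars F"
  shows "ldeg F l \<noteq> 1"
proof
  assume "ldeg F l = 1"
  note s = singular_split[OF sat this mindeg assms]
  have "card (vars (split F l)) < card (vars F)"
    unfolding s(3) using assms finite_vars[OF CS] by (intro psubset_card_mono) auto
  then show False using minimal[OF s(1) _ s(4)] s(2) delta by simp
qed

text \<open>By \<open>five_cases\<close> this is the only way to distribute nine occurrences; the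
  split at the more frequent literal then attains the bound 4 for deficiency 2.\<close>

definition five :: "lit \<Rightarrow> bool" where
  "five x \<longleftrightarrow> var_of x \<in> vars F \<and> ldeg F x = 5 \<and> ldeg F (comp x) = 4"

lemma five_vdeg: "five x \<Longrightarrow> vdeg F (var_of x) = 9"
  using vdeg_ldeg[OF CS, of x] by (simp add: five_def)

text \<open>Six occurrences would leave deficiency 1 with minimal degree at least 3; more would
  leave a deficiency below 1.\<close>

lemma ldeg_le_5:
  assumes "var_of x \<in> vars F" "vdeg F (var_of x) = 9"
  shows "ldeg F x \<le> 5"
proof -
  note s = min_degree_split[OF sat assms(1) mindeg assms(2)]
  have "ldeg F x \<le> 6" using delta_pos[OF s(1)] s(2) delta by simp
  moreover have "ldeg F x \<noteq> 6"
  proof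
    assume 6: "ldeg F x = 6"
    have "vars (split F x) \<noteq> {}" using split_vars_nonempty[OF MU _ s(3) assms(1)] delta by simp
    then show False using degree_boundD[OF degree_bound_1 s(1) _ _ s(4)] s(2) delta 6 by simp
  qed
  ultimately show ?thesis by simp
qed

lemma five_cases:
  assumes "var_of x \<in> vars F" "vdeg F (var_of x) = 9"
  shows "five x \<or> five (comp x)"
proof -
  have "ldeg F x \<le> 5" "ldeg F (comp x) \<le> 5" using ldeg_le_5[of x] ldeg_le_5[of "comp x"] assms by auto
  moreover have "ldeg F x + ldeg F (comp x) = 9" using vdeg_ldeg[OF CS, of x] assms(2) by simp
  ultimately show ?thesis using assms(1) unfolding five_def by auto
qed

lemma ex_five: "\<exists>x. five x"
proof -
  have "vars F \<noteq> {}" using vars_nonempty[OF MU] delta by simp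
  then have "\<not> mindeg_ge F 10" using degree_boundD[OF degree_bounds(5) MU delta, of 10] by auto
  then obtain v where v: "v \<in> vars F" "vdeg F v < 10" by (auto simp: mindeg_ge_def)
  then have "vdeg F v = 9" using mindeg by (fastforce simp: mindeg_ge_def)
  moreover obtain x where "var_of x = v" using vars_litE[OF v(1)] .
  ultimately show ?thesis using five_cases[of x] v(1) by auto
qed

lemma five_split:
  assumes "five x"
  shows "MU (split F x)" "delta (split F x) = 2" "vars (split F x) = vars F - {var_of x}" "mindeg_ge (split F x) 4"
proof -
  have "var_of x \<in> vars F" "ldeg F x = 5" using assms by (auto simp: five_def)
  then show "MU (split F x)" "delta (split F x) = 2" "vars (split F x) = vars F - {var_of x}" "mindeg_ge (split F x) 4"
    using min_degree_split[OF sat _ mindeg five_vdeg[OF assms]] delta by simp_all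
qed

text \<open>A degree of at least 9 can fall to 4 only if all five removed clauses contain the
  variable.\<close>

lemma five_degree_4:
  assumes "five x" "w \<in> vars (split F x)" "vdeg (split F x) w = 4"
  shows "vdeg F w = 9" and "C \<in> F \<Longrightarrow> x \<in> C \<Longrightarrow> w \<in> var_of ` C"
proof -
  have w: "w \<noteq> var_of x" "w \<in> vars F" using assms(2) five_split(3)[OF assms(1)] by auto
  have x: "card {C\<in>F. x \<in> C} = 5" using assms(1) by (simp add: five_def ldeg_def)
  have sub: "{C\<in>F. x \<in> C \<and> w \<in> var_of ` C} \<subseteq> {C\<in>F. x \<in> C}" by blast
  have fx: "finite {C\<in>F. x \<in> C}" using fin by simp
  have "9 \<le> vdeg F w" using mindeg w(2) by (auto simp: mindeg_ge_def)
  then have ge: "5 \<le> card {C\<in>F. x \<in> C \<and> w \<in> var_of ` C}" using vdeg_split[OF MU w(1)] assms(3) by simp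
  then have eq: "{C\<in>F. x \<in> C \<and> w \<in> var_of ` C} = {C\<in>F. x \<in> C}"
    using x by (intro card_seteq[OF fx sub]) simp
  then show "vdeg F w = 9" using vdeg_split[OF MU w(1)] assms(3) x by simp
  show "w \<in> var_of ` C" if "C \<in> F" "x \<in> C" using eq that by blast
qed

text \<open>A binary clause \<open>{comp x, l}\<close> forces, by saturation, \<open>x\<close> into every other clause with \<open>l\<close>,
  so that setting \<open>l\<close> to true makes the variable of \<open>x\<close> the only one of minimal degree.\<close>

lemma binary_clause_vdeg:
  assumes x: "five x" and E: "{comp x, l} \<in> F" and ne: "var_of l \<noteq> var_of x"
  shows "vdeg F (var_of l) \<noteq> 9"
proof
  assume l9: "vdeg F (var_of l) = 9"
  define E0 where "E0 = {comp x, l}"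
  have E0: "E0 \<in> F" "l \<in> E0" "comp x \<in> E0" using E by (auto simp: E0_def)
  have lv: "var_of l \<in> vars F" using E0 by (auto simp: vars_def)
  have xv: "var_of x \<in> vars F" "ldeg F x = 5" "ldeg F (comp x) = 4" using x by (auto simp: five_def)
  define n where "n = ldeg F l"
  have n: "n = 4 \<or> n = 5" using five_cases[OF lv l9] by (auto simp: five_def n_def)
  \<comment> \<open>An assignment falsifying \<open>C\<close> falsifies \<open>l\<close>, so it
    satisfies \<open>E0\<close> only by making \<open>comp x\<close> true.\<close>
  have key: "x \<in> C" if C: "C \<in> F" "l \<in> C" "C \<noteq> E0" for C
  proof (rule saturated_mem[OF sat C(1) xv(1)])
    fix \<phi> assume \<phi>: "sat_by \<phi> (F - {C})" "\<And>z. z \<in> C \<Longrightarrow> \<not> lit_true \<phi> z"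
    have "E0 \<in> F - {C}" using E0 C by blast
    then have "\<exists>z\<in>E0. lit_true \<phi> z" using \<phi>(1) by (simp add: sat_by_def)
    then show "\<not> lit_true \<phi> x" using \<phi>(2)[OF C(2)] by (auto simp: E0_def)
  qed
  have lC: "{C\<in>F. l \<in> C} = insert E0 {C\<in>F. l \<in> C \<and> x \<in> C}" using key E0 by blast
  have "x \<notin> E0" using ne by (auto simp: E0_def)
  then have cn: "Suc (card {C\<in>F. l \<in> C \<and> x \<in> C}) = n"
    unfolding n_def ldeg_def lC using fin by simp
  have "{C\<in>F. l \<in> C \<and> comp x \<in> C} = {E0}"
  proof (intro equalityI subsetI)
    fix C assume "C \<in> {C\<in>F. l \<in> C \<and> comp x \<in> C}"
    then have "C \<in> F" "l \<in> C" "comp x \<in> C" by auto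
    then show "C \<in> {E0}" using key[of C] MU_comp[OF MU, of C x] by auto
  qed (use E0 in auto)
  then have c1: "card {C\<in>F. l \<in> C \<and> comp x \<in> C} = 1" by simp
  define H where "H = split F l"
  have le: "9 - n + ldeg F l \<le> vdeg F w" if "w \<in> vars F" for w
    using that mindeg n by (auto simp: mindeg_ge_def n_def)
  have "0 < 9 - n" using n by auto
  note H = degree_split[OF sat lv le this, folded H_def]
  have dH: "delta H = 7 - int n" using H(2) delta by (simp add: n_def)
  have nx: "var_of x \<noteq> var_of l" "var_of (comp x) \<noteq> var_of l" using ne by auto
  \<comment> \<open>The literal \<open>x\<close> loses \<open>n - 1\<close> of its five occurrences,
    \<open>comp x\<close> loses only the one in \<open>E0\<close>.\<close>
  have ldx: "ldeg H x = 6 - n" "ldeg H (comp x) = 3"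
    using ldeg_split[OF MU nx(1)] ldeg_split[OF MU nx(2)] xv cn c1 unfolding H_def by auto
  \<comment> \<open>A variable outside \<open>E0\<close> is spared by \<open>E0\<close> and loses at
    most \<open>n - 1\<close> occurrences.\<close>
  have oth: "10 - n \<le> vdeg H w" if w: "w \<in> vars H" "w \<noteq> var_of x" for w
  proof -
    have w': "w \<noteq> var_of l" "w \<in> vars F" using w(1) H(3) by auto
    have "w \<notin> var_of ` E0" using w(2) w'(1) by (auto simp: E0_def)
    then have "{C\<in>F. l \<in> C \<and> w \<in> var_of ` C} \<subseteq> {C\<in>F. l \<in> C \<and> x \<in> C}" using key by blast
    then have "card {C\<in>F. l \<in> C \<and> w \<in> var_of ` C} \<le> card {C\<in>F. l \<in> C \<and> x \<in> C}"
      using fin by (intro card_mono) auto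
    moreover have "9 \<le> vdeg F w" using mindeg w'(2) by (auto simp: mindeg_ge_def)
    ultimately show ?thesis using vdeg_split[OF MU w'(1)] cn unfolding H_def by simp
  qed
  obtain S where S: "saturated S" "delta S = delta H" "vars S = vars H"
    and up: "\<And>w. vdeg H w \<le> vdeg S w" "\<And>z. ldeg H z \<le> ldeg S z"
    using saturation_mindeg[OF H(1,4)] by metis
  note MUS = saturated_MU[OF S(1)]
  have nonempty: "vars S \<noteq> {}" using vars_nonempty[OF MUS] S(2) dH n by auto
  \<comment> \<open>For \<open>n = 4\<close> and \<open>n = 5\<close> the deficiency is 3 and 2, and
    \<open>10 - n\<close> exceeds the bounds 5 and 4. So the variable of \<open>x\<close> must keep
    degree \<open>9 - n\<close> in \<open>S\<close>, which fixes both of its literal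
    degrees.\<close>
  have "\<not> mindeg_ge S (10 - n)"
    using degree_boundD[OF degree_bounds(1) MUS _ nonempty, of "10 - n"]
      degree_boundD[OF degree_bounds(2) MUS _ nonempty, of "10 - n"] S(2) dH n by auto
  then obtain w where w: "w \<in> vars S" "vdeg S w < 10 - n" by (auto simp: mindeg_ge_def not_le)
  then have "w = var_of x" using oth[of w] up(1)[of w] S(3) by fastforce
  with w have "vdeg S (var_of x) < 10 - n" and xS: "var_of (comp x) \<in> vars S" by auto
  then have "ldeg S (comp x) = 3"
    using vdeg_ldeg[OF MU_clause_set[OF MUS], of x] up(2)[of x] up(2)[of "comp x"] ldx n by auto
  note l3 = this
  \<comment> \<open>Splitting once more at \<open>comp x\<close>, with its three occurrences, leaves
    deficiency \<open>5 - n\<close>. This rules out \<open>n = 5\<close>, and for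
    \<open>n = 4\<close> minimal degree 3 is too large for deficiency 1.\<close>
  have "7 - n + ldeg S (comp x) \<le> vdeg S u" if u: "u \<in> vars S" "u \<noteq> var_of (comp x)" for u
    using oth[of u] up(1)[of u] u S(3) l3 n by fastforce
  moreover have "0 < 7 - n" using n by auto
  ultimately have s: "MU (split S (comp x))" "delta (split S (comp x)) = 5 - int n"
    "vars (split S (comp x)) = vars S - {var_of (comp x)}" "mindeg_ge (split S (comp x)) (7 - n)"
    using degree_split[OF S(1) xS, of "7 - n"] S(2) dH l3 by auto
  have "n = 4" using delta_pos[OF s(1)] s(2) n by auto
  moreover have "vars (split S (comp x)) \<noteq> {}"
    using split_vars_nonempty[OF MUS _ s(3) xS] S(2) dH n by auto
  ultimately show False using degree_boundD[OF degree_bound_1 s(1) _ _ s(4)] s(2) by simp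
qed

lemma core_var:
  assumes "five x" "core (split F x) K" "v \<in> K"
  shows "v \<in> vars F" "v \<noteq> var_of x" "vdeg F v = 9" "\<And>C. C \<in> F \<Longrightarrow> x \<in> C \<Longrightarrow> v \<in> var_of ` C"
proof -
  have v: "v \<in> vars (split F x)" "vdeg (split F x) v = 4" using assms(2,3) unfolding core_def by blast+
  then show "v \<in> vars F" "v \<noteq> var_of x" using five_split(3)[OF assms(1)] by auto
  show "vdeg F v = 9" "\<And>C. C \<in> F \<Longrightarrow> x \<in> C \<Longrightarrow> v \<in> var_of ` C"
    using five_degree_4[OF assms(1) v] by blast+
qed

text \<open>A unit clause \<open>{l}\<close> of \<open>split F y\<close> stems from a unit clause of
  \<open>F\<close>, so that \<open>l\<close> occurs only once, or from \<open>{comp y, l}\<close>.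
  In the second case \<open>l\<close> does not have degree 9, so the clause is unchanged in
  \<open>split F x\<close>; as a clause with \<open>comp y\<close> it contains a further core
  variable, which has degree 9.\<close>

lemma core_no_unit:
  assumes x: "five x" "core (split F x) K" and w: "w \<in> K"
  obtains y where "five y" "var_of y = w" "\<forall>l. {l} \<notin> split F y"
proof -
  note cw = core_var[OF x w]
  obtain y where y: "five y" "var_of y = w"
    using five_cases cw(1,3) vars_litE[OF cw(1)] by (metis var_of_comp)
  have "{l} \<notin> split F y" for l
  proof
    assume "{l} \<in> split F y"
    then obtain C where C: "C \<in> F" "y \<notin> C" "C - {comp y} = {l}" by (auto simp: split_def)
    then have l: "l \<in> C" "l \<noteq> comp y" "l \<noteq> y" by auto
    then have vl: "var_of l \<noteq> var_of y" by (simp add: var_of_eq_iff)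
    have lv: "var_of l \<in> vars F" using l(1) C(1) by (auto simp: vars_def)
    show False
    proof (cases "comp y \<in> C")
      case False
      then have Cl: "C = {l}" using C(3) by auto
      have "{D\<in>F. l \<in> D} = {C}" using MU_subset_eq[OF MU C(1)] Cl C(1) by blast
      then have "ldeg F l = 1" by (simp add: ldeg_def)
      then show False using not_singular[OF lv] by simp
    next
      case True
      then have Cl: "C = {comp y, l}" using C(3) by auto
      have n9: "vdeg F (var_of l) \<noteq> 9" using binary_clause_vdeg[OF y(1) _ vl] C(1) Cl by simp
      then have "var_of l \<noteq> var_of x" using five_vdeg[OF x(1)] by auto
      moreover have "var_of y \<noteq> var_of x" using cw(2) y(2) by simp
      ultimately have "x \<notin> C" "comp x \<notin> C" unfolding Cl by auto
      then have Cs: "C \<in> split F x" using C(1) by (auto simp: split_def intro: rev_image_eqI)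
      have "var_of (comp y) \<in> K" using y(2) w by simp
      then obtain u A B where u: "var_of u \<in> K" "var_of u \<noteq> var_of (comp y)"
          "{E\<in>split F x. comp y \<in> E} = {A, B}" "u \<in> A" "comp u \<in> B"
        by (rule core_clauses[OF x(2)])
      have "C \<in> {E\<in>split F x. comp y \<in> E}" using Cs True by simp
      then have "C = A \<or> C = B" unfolding u(3) by simp
      then have "u \<in> C \<or> comp u \<in> C" using u(4,5) by auto
      then have "var_of u = var_of l" using u(2) unfolding Cl by auto
      then show False using n9 core_var(3)[OF x u(1)] by simp
    qed
  qed
  then show ?thesis using that y by blast
qed

text \<open>A binary clause \<open>{y, q}\<close> of \<open>split F x\<close> stems from a clause of
  \<open>F\<close> with \<open>y\<close> over the variables of \<open>x\<close>, \<open>y\<close>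
  and \<open>q\<close>. All core variables of \<open>split F y\<close> occur in that clause, leaving
  only those of \<open>q\<close> and \<open>x\<close>; and a core has at least two
  variables.\<close>

lemma core_pair:
  assumes x: "five x" "core (split F x) K" "\<forall>l. {l} \<notin> split F x"
    and y: "five y" "var_of y \<in> K" "core (split F y) K'"
  obtains p where "p \<in> K" "p \<noteq> var_of y" "K' = {p, var_of x}"
proof -
  obtain q where q: "var_of q \<in> K" "var_of q \<noteq> var_of y" "{y, q} \<in> split F x"
    by (rule core_binary[OF x(2) y(2) x(3)])
  then obtain E where E: "E \<in> F" "E - {comp x} = {y, q}" by (auto simp: split_def)
  have sub: "K' \<subseteq> {var_of q, var_of x}"
  proof
    fix v assume v: "v \<in> K'"
    have "y \<in> E" using E(2) by blast
    then have "v \<in> var_of ` E" using core_var(4)[OF y(1,3) v E(1)] by blast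
    moreover have "E \<subseteq> {comp x, y, q}" using E(2) by blast
    ultimately have "v \<in> {var_of x, var_of y, var_of q}" by auto
    then show "v \<in> {var_of q, var_of x}" using core_var(2)[OF y(1,3) v] by auto
  qed
  obtain v where v: "v \<in> K'" using y(3) unfolding core_def by blast
  then obtain z where z: "var_of z = v" using vars_litE core_var(1)[OF y(1,3)] by metis
  then have zK: "var_of z \<in> K'" using v by simp
  obtain u A B where u: "var_of u \<in> K'" "var_of u \<noteq> var_of z"
    "{E\<in>split F y. z \<in> E} = {A, B}" "u \<in> A" "comp u \<in> B"
    by (rule core_clauses[OF y(3) zK])
  have "var_of q \<in> K'" "var_of x \<in> K'" using zK u(1,2) sub by (metis insertE singletonD subsetD)+
  with sub have "K' = {var_of q, var_of x}" by blast
  then show ?thesis using that q(1,2) by blast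
qed

lemma contradiction: False
proof -
  obtain x0 where "five x0" using ex_five by blast
  moreover from this obtain K0 where "core (split F x0) K0" using MU2_core five_split(1,2,4) by blast
  moreover from this obtain w0 where "w0 \<in> K0" unfolding core_def by blast
  ultimately obtain x where x: "five x" "\<forall>l. {l} \<notin> split F x" by (rule core_no_unit)
  obtain K where K: "core (split F x) K" using MU2_core[OF five_split(1)[OF x(1)] five_split(2)[OF x(1)] five_split(4)[OF x(1)]] .
  then obtain w where "w \<in> K" unfolding core_def by blast
  with x(1) K obtain y where y: "five y" "var_of y = w" "\<forall>l. {l} \<notin> split F y" by (rule core_no_unit)
  have wK: "var_of y \<in> K" using y(2) \<open>w \<in> K\<close> by simp
  obtain K' where K': "core (split F y) K'"
    using MU2_core[OF five_split(1)[OF y(1)] five_split(2)[OF y(1)] five_split(4)[OF y(1)]] .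
  \<comment> \<open>Applying \<open>core_pair\<close> in both directions leaves a single core
    variable \<open>p\<close> common to both splits.\<close>
  obtain p where p: "p \<in> K" "p \<noteq> var_of y" "K' = {p, var_of x}"
    by (rule core_pair[OF x(1) K x(2) y(1) wK K'])
  then have xK': "var_of x \<in> K'" by simp
  obtain p' where p': "p' \<in> K'" "p' \<noteq> var_of x" "K = {p', var_of y}"
    by (rule core_pair[OF y(1) K' y(3) x(1) xK' K])
  then have Kp: "K = {p, var_of y}" using p by auto
  define G where "G = split F x"
  note G = five_split[OF x(1), folded G_def]
  have Kvar: "p \<in> vars G" "vdeg G p = 4" using K p(1) unfolding core_def G_def by auto
  obtain u A B where u: "var_of u \<in> K" "var_of u \<noteq> var_of y" "{E\<in>G. y \<in> E} = {A, B}" "u \<in> A" "comp u \<in> B"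
    unfolding G_def by (rule core_clauses[OF K wK])
  have up: "var_of u = p" using u(1,2) Kp by auto
  have wK': "var_of (comp y) \<in> K" using wK by simp
  obtain u' A' B' where u': "var_of u' \<in> K" "var_of u' \<noteq> var_of (comp y)" "{E\<in>G. comp y \<in> E} = {A', B'}" "u' \<in> A'" "comp u' \<in> B'"
    unfolding G_def by (rule core_clauses[OF K wK'])
  \<comment> \<open>The core has just two variables, so the clauses with \<open>comp y\<close> clash
    on the same variable as those with \<open>y\<close>, and all four sign patterns occur.\<close>
  have "u' = u \<or> u' = comp u" using u'(1,2) Kp up by (auto simp: var_of_eq_iff)
  then obtain A'' B'' where A'': "{E\<in>G. comp y \<in> E} = {A'', B''}" "u \<in> A''" "comp u \<in> B''"
    using u'(3-5) by (metis comp_comp insert_commute)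
  have vu: "vdeg G (var_of u) = 4" using up Kvar by simp
  obtain H where H: "MU H" "delta H = delta G - 1" "vars H = vars G - {var_of y, var_of u}"
    and deg: "\<And>q. q \<notin> {var_of y, var_of u} \<Longrightarrow> vdeg G q \<le> vdeg H q + (card {C\<in>{A, B, A'', B''}. q \<in> var_of ` C} - 1)"
    using square_contraction[OF G(1) u(3) A''(1) u(4,5) A''(2,3) vu u(2)] by blast
  \<comment> \<open>Two of the four clauses are binary and contain only the two core variables. Any
    other variable occurs in at most two of the four and loses at most 1 by the contraction.\<close>
  obtain q1 where q1: "var_of q1 \<in> K" "var_of q1 \<noteq> var_of y" "{y, q1} \<in> G"
    unfolding G_def by (rule core_binary[OF K wK x(2)])
  obtain q2 where q2: "var_of q2 \<in> K" "var_of q2 \<noteq> var_of (comp y)" "{comp y, q2} \<in> G"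
    unfolding G_def by (rule core_binary[OF K wK' x(2)])
  have qp: "var_of q1 = p" "var_of q2 = p" using q1 q2 Kp by auto
  have b1: "{y, q1} \<in> {A, B}" using q1(3) unfolding u(3)[symmetric] by simp
  have b2: "{comp y, q2} \<in> {A'', B''}" using q2(3) unfolding A''(1)[symmetric] by simp
  have b12: "{y, q1} \<noteq> {comp y, q2}"
    using q1(2) q2(2) by (metis comp_neq(1) insertE insertI1 singletonD var_of_comp)
  \<comment> \<open>A variable of degree at most 2 in \<open>H\<close>, which exists in deficiency
    1, would have degree at most 3 in \<open>G\<close>.\<close>
  have "vars H = {}"
  proof (rule ccontr)
    assume ne: "vars H \<noteq> {}"
    have "delta H = 1" using H(2) G(2) by simp
    then have "\<not> mindeg_ge H 3" using degree_boundD[OF degree_bound_1 H(1) _ ne, of 3] by auto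
    then obtain q where q: "q \<in> vars H" "vdeg H q < 3" by (auto simp: mindeg_ge_def)
    then have qn: "q \<notin> {var_of y, var_of u}" "q \<in> vars G" using H(3) by auto
    have "q \<notin> var_of ` {y, q1}" "q \<notin> var_of ` {comp y, q2}" using qn(1) qp up by auto
    then have "{C\<in>{A, B, A'', B''}. q \<in> var_of ` C} \<subseteq> {A, B, A'', B''} - {{y, q1}, {comp y, q2}}" by blast
    then have "card {C\<in>{A, B, A'', B''}. q \<in> var_of ` C} \<le> card ({A, B, A'', B''} - {{y, q1}, {comp y, q2}})"
      by (intro card_mono) auto
    also have "\<dots> = card {A, B, A'', B''} - 2"
      using b1 b2 b12 by (subst card_Diff_subset) auto
    also have "\<dots> \<le> 2" using card_insert_le_m1[of 4 "{B, A'', B''}" A] card_length[of "[A, B, A'', B'']"] by simp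
    finally have "vdeg G q \<le> 3" using deg[OF qn(1)] q(2) by linarith
    then show False using G(4) qn(2) by (auto simp: mindeg_ge_def)
  qed
  then have vF: "vars F \<subseteq> {var_of x, var_of y, var_of u}" using H(3) G(3) by auto
  \<comment> \<open>Each clause with \<open>x\<close> contains the other two variables as well, so
    it is determined by their two signs; but there are five such clauses.\<close>
  have "inj_on (\<lambda>C. (y \<in> C, u \<in> C)) {C\<in>F. x \<in> C}"
  proof (rule inj_onI)
    have sub: "C \<subseteq> D" if C: "C \<in> F" "x \<in> C" and D: "D \<in> F" "x \<in> D" and eq: "y \<in> C \<longleftrightarrow> y \<in> D" "u \<in> C \<longleftrightarrow> u \<in> D" for C D
    proof
      fix z assume z: "z \<in> C"
      then have "var_of z \<in> {var_of x, var_of y, var_of u}" using C(1) vF by (auto simp: vars_def)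
      then consider "z = x" | "z = comp x" | "z = y" | "z = comp y" | "z = u" | "z = comp u"
        by (auto simp: var_of_eq_iff)
      then show "z \<in> D"
      proof cases
        case 2 then show ?thesis using MU_comp[OF MU C] z by simp
      next
        case 4
        then have "y \<notin> D" using MU_comp[OF MU C(1) z] eq(1) by simp
        moreover have "var_of y \<in> var_of ` D" using core_var(4)[OF x(1) K wK D] .
        ultimately show ?thesis using 4 by (simp add: var_of_image_iff)
      next
        case 6
        then have "u \<notin> D" using MU_comp[OF MU C(1) z] eq(2) by simp
        moreover have "var_of u \<in> var_of ` D" using core_var(4)[OF x(1) K u(1) D] .
        ultimately show ?thesis using 6 by (simp add: var_of_image_iff)
      qed (use D eq z in auto)
    qed
    fix C D assume "C \<in> {C\<in>F. x \<in> C}" "D \<in> {C\<in>F. x \<in> C}" "(y \<in> C, u \<in> C) = (y \<in> D, u \<in> D)"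
    then show "C = D" using sub[of C D] sub[of D C] by auto
  qed
  then have "card {C\<in>F. x \<in> C} \<le> card (UNIV :: (bool \<times> bool) set)"
    by (rule card_inj_on_le) auto
  also have "\<dots> = 4" by (simp add: card_UNIV_bool card_cartesian_product flip: UNIV_Times_UNIV)
  finally show False using x(1) by (simp add: five_def ldeg_def)
qed

end

lemma degree_bound_6: "degree_bound 6 8"
proof (rule ccontr)
  assume "\<not> degree_bound 6 8"
  then obtain F m where F: "MU F" "delta F = 6" "mindeg_ge F m" "\<not> m \<le> 8"
    unfolding degree_bound_def by blast
  then have "mindeg_ge F 9" using mindeg_ge_mono[of F m 9] by simp
  with F have "\<exists>F. MU F \<and> delta F = 6 \<and> mindeg_ge F 9" by blast
  then obtain F where F: "MU F \<and> delta F = 6 \<and> mindeg_ge F 9"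
      "\<And>G. MU G \<and> delta G = 6 \<and> mindeg_ge G 9 \<Longrightarrow> card (vars F) \<le> card (vars G)"
    using ex_has_least_nat[of "\<lambda>F. MU F \<and> delta F = 6 \<and> mindeg_ge F 9" _ "\<lambda>F. card (vars F)"] by blast
  \<comment> \<open>Saturating keeps the variables, so \<open>S\<close> is still a counterexample
    with the fewest variables.\<close>
  obtain S where "saturated S" "delta S = delta F" "vars S = vars F" "mindeg_ge S 9"
    using saturation_mindeg[of F 9] F(1) by metis
  with F have "minimal_counterexample S" by unfold_locales auto
  then show False by (rule minimal_counterexample.contradiction)
qed

section \<open>The recursion for \<open>nM\<close> and the final bound\<close>

lemma nM_aux_eq: "1 \<le> j \<Longrightarrow> j \<le> n \<Longrightarrow> nM_aux f n j = nM f j"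
proof (induction n)
  case (Suc n)
  then show ?case by (cases "j = Suc n") (auto simp: nM_def Let_def simp del: One_nat_def)
qed simp

lemma nM_1: "nM f 1 = 2"
  by (simp add: nM_def)

lemma nM_rec:
  assumes "2 \<le> k"
  shows "nM f k = min (enat (GREATEST m. m \<in> {4..2 * k} \<and> pdp (nM_aux f (k - 1)) k m \<noteq> {})) (f k)"
proof -
  obtain n where "k = Suc n" using assms by (cases k) auto
  then show ?thesis using assms by (simp add: nM_def Let_def)
qed

text \<open>By induction both splits at a variable of minimal degree obey \<open>N1\<close>, which
  gives exactly the inequalities in \<open>pdp\<close>; so the two literal degrees form an
  admissible pair. The other term of the minimum is covered by the explicit bounds up to deficiency
  6.\<close>

lemma mindeg_le_N1:
  assumes "1 \<le> k" "MU F" "delta F = int k" "vars F \<noteq> {}" "mindeg_ge F m"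
  shows "enat m \<le> N1 k"
  using assms
proof (induction k arbitrary: F m rule: less_induct)
  case (less k)
  show ?case
  proof (cases "k = 1")
    case True
    then have "m \<le> 2" using degree_boundD[OF degree_bound_1] less.prems by auto
    then show ?thesis using True nM_1[of f_248] by (simp add: N1_def numeral_eq_enat)
  next
    case False
    then have k: "2 \<le> k" using less.prems(1) by simp
    define P where "P = (\<lambda>m. m \<in> {4..2 * k} \<and> pdp (nM_aux f_248 (k - 1)) k m \<noteq> {})"
    have "degree_bound (int k) (GREATEST m. P m)"
    proof (rule degree_bound_step)
      fix e e' G G'
      assume *: "(GREATEST m. P m) < e + e'" "2 \<le> e" "e \<le> e'"
        "MU G" "delta G = int k - int e + 1" "vars G \<noteq> {}" "mindeg_ge G e'"
        "MU G'" "delta G' = int k - int e' + 1" "vars G' \<noteq> {}" "mindeg_ge G' e"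
      \<comment> \<open>Together with \<open>2 \<le> e\<close> this keeps \<open>k - e + 1\<close>
        and \<open>k - e' + 1\<close> between 1 and \<open>k - 1\<close>, where the induction
        hypothesis applies.\<close>
      have e': "e' \<le> k" using delta_pos[OF *(8)] *(9) by simp
      have G: "delta G = int (k - e + 1)" "delta G' = int (k - e' + 1)" using * e' by (auto simp: of_nat_diff)
      have lt: "k - e + 1 < k" "k - e' + 1 < k" using * e' by auto
      have "enat e' \<le> N1 (k - e + 1)" "enat e \<le> N1 (k - e' + 1)"
        using less.IH[OF lt(1) _ *(4) G(1) *(6,7)] less.IH[OF lt(2) _ *(8) G(2) *(10,11)] by simp_all
      moreover have "nM_aux f_248 (k - 1) (k - e + 1) = N1 (k - e + 1)" "nM_aux f_248 (k - 1) (k - e' + 1) = N1 (k - e' + 1)"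
        using nM_aux_eq[of "k - e + 1" "k - 1" f_248] nM_aux_eq[of "k - e' + 1" "k - 1" f_248] lt by (auto simp: N1_def)
      ultimately have "enat (e' + e) \<le> nM_aux f_248 (k - 1) (k - e + 1) + enat e"
          "enat (e + e') \<le> nM_aux f_248 (k - 1) (k - e' + 1) + enat e'"
        unfolding plus_enat_simps(1)[symmetric] by (simp_all only: add_right_mono)
      then have "(e, e') \<in> pdp (nM_aux f_248 (k - 1)) k (e + e')"
        using * e' by (auto simp: pdp_def add.commute)
      then have "P (e + e')" using * e' by (auto simp: P_def)
      \<comment> \<open>The upper limit \<open>2 * k\<close> guarantees that a greatest element
        exists.\<close>
      then have "e + e' \<le> (GREATEST m. P m)"
        by (rule Greatest_le_nat[where b = "2 * k"]) (auto simp: P_def)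
      then show False using *(1) by simp
    qed (use k in simp)
    then have "m \<le> (GREATEST m. P m)" using degree_boundD less.prems by blast
    moreover have "enat m \<le> f_248 k"
    proof -
      have "m \<le> b" if "degree_bound (int k) b" for b using degree_boundD[OF that] less.prems by blast
      then have "k = 2 \<Longrightarrow> m \<le> 4" "k = 3 \<Longrightarrow> m \<le> 5" "k = 4 \<Longrightarrow> m \<le> 6" "k = 5 \<Longrightarrow> m \<le> 8" "k = 6 \<Longrightarrow> m \<le> 8"
        using degree_bounds degree_bound_6 by auto
      then show ?thesis using k by (auto simp: f_248_def numeral_eq_enat)
    qed
    ultimately show ?thesis unfolding N1_def nM_rec[OF k] P_def by simp
  qed
qed

theorem theorem14p6:
  fixes k :: nat
  assumes "k \<ge> 1"
  shows "minvdeg_class (MU_delta (int k)) \<le> N1 k"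
  unfolding minvdeg_class_def
proof (rule Sup_least)
  fix d assume "d \<in> {enat (minvdeg F) |F. F \<in> MU_delta (int k) \<and> vars F \<noteq> {}}"
  then obtain F where F: "d = enat (minvdeg F)" "MU F" "delta F = int k" "vars F \<noteq> {}"
    by (auto simp: MU_delta_def)
  have "mindeg_ge F (minvdeg F)"
    using finite_vars[OF MU_clause_set[OF F(2)]] by (auto simp: mindeg_ge_def minvdeg_def)
  then show "d \<le> N1 k" using mindeg_le_N1[OF assms F(2-4)] F(1) by simp
qed

end
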